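(* Let $\mathcal M\hat x^{\perp}$ denote the orthogonal complement of the primary $T$-module $\mathcal M\hat x$ in $\mathbf W=\mathrm{Span}\{\hat C_i^{-},\hat C_i^{+}:0\le i\le d-1\}$. The $T$-module $\mathcal M\hat x^{\perp}$ is irreducible and thin, with endpoint $1$, dual endpoint $1$, and diameter $d-2$.
   Context: **Graph.** $\Gamma$ is a finite undirected connected graph without loops or multiple edges, with vertex set $X$, path-length distance $\partial$ and diameter $d\ge 3$; $\Gamma_i(y)=\{z\in X:\partial(y,z)=i\}$, $\Gamma(y)=\Gamma_1(y)$. $\Gamma$ is distance-regular: $p^h_{ij}=|\Gamma_i(y)\cap\Gamma_j(z)|$ depends only on $i,j$ and $h=\partial(y,z)$. Put $a_i=p^i_{1,i}$, $b_i=p^i_{1,i+1}$, $c_i=p^i_{1,i-1}$ ($b_d=c_0=0$), $k=b_0$. Complex matrices indexed by $X$ act on $\mathbf V=\mathbb C^X$ with inner product $\langle u,v\rangle=u^t\overline v$; $\hat y$ is the standard basis vector at $y$, $\hat Y=\sum_{y\in Y}\hat y$, $\mathbf j=\hat X$. $A_i$ is the $i$-th distance matrix, $A=A_1$, $\mathcal M$ is the algebra generated by $A$ (Bose–Mesner algebra), with primitive idempotents $E_0=|X|^{-1}J,E_1,\dots,E_d$ ($J$ all-ones) and $A=\sum_i\theta_iE_i$. $\Gamma$ is $Q$-polynomial with respect to $E_0,\dots,E_d$: writing $E_i\circ E_j=|X|^{-1}\sum_h q^h_{ij}E_h$ (entrywise product), $q^h_{ij}=0$ (resp. $\ne0$)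 if one of $h,i,j$ is greater than (resp. equal to) the sum of the other two. It is assumed that $\theta_0>\theta_1>\dots>\theta_d$. **Clique and Terwilliger algebra.** $C\subseteq X$ is a Delsarte clique: a nonempty set of mutually adjacent vertices with $|C|=1-k/\theta_d$. Fix $x\in C$. $A^*=A^*(x)$ is the diagonal matrix with $(z,z)$-entry $|X|(E_1)_{xz}$; $E^*_i$ ($0\le i\le d$) is the diagonal projection onto $\mathrm{Span}\{\hat z:\partial(x,z)=i\}$, and $A^*=\sum_i\theta^*_iE^*_i$. $T$ is the algebra generated by $A,A^*$. A $T$-module is a subspace of $\mathbf V$ invariant under $T$. For an irreducible $T$-module $W$: the endpoint is $\min\{i:E_i^*W\ne0\}$, the dual endpoint is $\min\{i:E_iW\neq0\}$, the diameter is $|\{i:E_i^*W\ne0\}|-1$, and $W$ is thin if $\dim E_i^*W\le1$ for all $i$ (equivalently $\dim E_iW\le1$ for all $i$). For $0\le i\le d-1$, $C_i=\{y\in X:\partial(y,C)=i\}$ (these partition $X$); $C_i^-=C_i\cap\Gamma_i(x)$, $C_i^+=C_i\cap\Gamma_{i+1}(x)$. $\mathbf W$ is a $T$-module containing $\mathcal M\hat x$. **Leonard systems.** On a complex vector space $V$ of dimension $n+1$, a Leonard system of diameter $n$ is a sequence $(B;B^*;\{F_i\}_{i=0}^n;\{F^*_i\}_{i=0}^n)$ where $B,B^*\in\mathrm{End}(V)$ each have $n+1$ distinct eigenvalues, $\{F_i\}$ (resp. $\{F_i^*\}$) is an ordering of the primitive idempotents (spectral projections) of $B$ (resp. $B^*$),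 and $F_iB^*F_j$, $F^*_iBF^*_j$ are $0$ if $|i-j|>1$ and nonzero if $|i-j|=1$. Eigenvalues $\vartheta_i$, dual eigenvalues $\vartheta^*_i$ are defined by $BF_i=\vartheta_iF_i$, $B^*F_i^*=\vartheta_i^*F_i^*$. The first split sequence is the sequence of nonzero scalars $\varphi_1,\dots,\varphi_n$ such that in some basis $B$ is lower bidiagonal with diagonal $\vartheta_0,\dots,\vartheta_n$ and subdiagonal entries $1$, and $B^*$ is upper bidiagonal with diagonal $\vartheta^*_0,\dots,\vartheta_n^*$ and superdiagonal $\varphi_1,\dots,\varphi_n$. The second split sequence $\{\phi_i\}$ is the first split sequence of $(B;B^*;\{F_{n-i}\};\{F^*_i\})$. The parameter array is $(\{\vartheta_i\},\{\vartheta_i^*\},\{\varphi_i\},\{\phi_i\})$. **$q$-Racah assumption.** $q\in\mathbb C$ is nonzero, $q^2\neq1$. $(A;A^*;\{E_i\}_{i=0}^d;\{E_i^*\}_{i=0}^d)$ acts on $\mathcal M\hat x$ (the primary $T$-module, of dimension $d+1$) as a Leonard system $\Phi$ with parameter array $(\{\theta_i\},\{\theta^*_i\},\{\varphi_i\},\{\phi_i\})$. $\Gamma$ is assumed to have $q$-Racah type: there are nonzero $h,h^*,s,s^*,r_1,r_2\in\mathbb C$ (fixed) with $r_1r_2=ss^*q^{d+1}$, none of $q^i,r_1q^i,r_2q^i,s^*q^i/r_1,s^*q^i/r_2$ equal to $1$ for $1\le i\le d$, neither of $sq^i,s^*q^i$ equal to $1$ for $2\le i\le 2d$, and $\theta_i=\theta_0+h(1-q^i)(1-sq^{i+1})q^{-i}$,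 $\theta^*_i=\theta^*_0+h^*(1-q^i)(1-s^*q^{i+1})q^{-i}$ ($0\le i\le d$), $\varphi_i=hh^*q^{1-2i}(1-q^i)(1-q^{i-d-1})(1-r_1q^i)(1-r_2q^i)$, $\phi_i=hh^*q^{1-2i}(1-q^i)(1-q^{i-d-1})(r_1-s^*q^i)(r_2-s^*q^i)/s^*$ ($1\le i\le d$). *)

theory Defs
  imports "HOL-Analysis.Analysis"
begin

text \<open>
  A finite graph is given by its adjacency relation on a finite vertex type, which plays the role
  of the vertex set. Vectors are elements of \<open>complex ^ 'v\<close> and matrices elements of
  \<open>complex ^ 'v ^ 'v\<close>; the complex linear structure is the one of the locale interpretation \<open>vec\<close>.
\<close>

section \<open>Distance-regular graphs\<close>

definition connected_simple_graph :: "('v \<Rightarrow> 'v \<Rightarrow> bool) \<Rightarrow> bool" where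
  "connected_simple_graph adj \<longleftrightarrow> symp adj \<and> irreflp adj \<and> (\<forall>y z. adj\<^sup>*\<^sup>* y z)"

definition gdist :: "('v \<Rightarrow> 'v \<Rightarrow> bool) \<Rightarrow> 'v \<Rightarrow> 'v \<Rightarrow> nat" where
  "gdist adj y z = (LEAST n. (adj ^^ n) y z)"

definition gdiam :: "('v::finite \<Rightarrow> 'v \<Rightarrow> bool) \<Rightarrow> nat" where
  "gdiam adj = Max {gdist adj y z | y z. True}"

definition gsphere :: "('v \<Rightarrow> 'v \<Rightarrow> bool) \<Rightarrow> nat \<Rightarrow> 'v \<Rightarrow> 'v set" where
  "gsphere adj i y = {z. gdist adj y z = i}"

text \<open>\<open>p h i j\<close> is the intersection number $p^h_{ij}$; it is unconstrained for \<open>h\<close> larger than the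
  diameter. The valency is $k = b_0 = p^0_{11}$.\<close>

definition distance_regular :: "('v \<Rightarrow> 'v \<Rightarrow> bool) \<Rightarrow> (nat \<Rightarrow> nat \<Rightarrow> nat \<Rightarrow> nat) \<Rightarrow> bool" where
  "distance_regular adj p \<longleftrightarrow>
     (\<forall>i j y z. card (gsphere adj i y \<inter> gsphere adj j z) = p (gdist adj y z) i j)"

definition valency :: "(nat \<Rightarrow> nat \<Rightarrow> nat \<Rightarrow> nat) \<Rightarrow> nat" where
  "valency p = p 0 1 1"


section \<open>Matrix algebras and idempotents\<close>

text \<open>The unital complex algebra generated by a set of matrices. Closure under scalar multiples
  comes from the scalar matrices \<open>mat c\<close>.\<close>

inductive_set gen_alg :: "(complex ^ 'v ^ 'v::finite) set \<Rightarrow> (complex ^ 'v ^ 'v) set"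
  for S where
    scalar: "mat c \<in> gen_alg S"
  | generator: "B \<in> S \<Longrightarrow> B \<in> gen_alg S"
  | plus: "B \<in> gen_alg S \<Longrightarrow> D \<in> gen_alg S \<Longrightarrow> B + D \<in> gen_alg S"
  | times: "B \<in> gen_alg S \<Longrightarrow> D \<in> gen_alg S \<Longrightarrow> B ** D \<in> gen_alg S"

definition idempotent_in :: "(complex ^ 'v ^ 'v::finite) set \<Rightarrow> complex ^ 'v ^ 'v \<Rightarrow> bool" where
  "idempotent_in M e \<longleftrightarrow> e \<in> M \<and> e \<noteq> 0 \<and> e ** e = e"

definition primitive_idempotent :: "(complex ^ 'v ^ 'v::finite) set \<Rightarrow> complex ^ 'v ^ 'v \<Rightarrow> bool" where
  "primitive_idempotent M e \<longleftrightarrow> idempotent_in M e \<and>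
     \<not> (\<exists>f g. idempotent_in M f \<and> idempotent_in M g \<and> f ** g = 0 \<and> g ** f = 0 \<and> e = f + g)"

definition adjacency_matrix :: "('v \<Rightarrow> 'v \<Rightarrow> bool) \<Rightarrow> complex ^ 'v ^ 'v::finite" where
  "adjacency_matrix adj = (\<chi> y z. if adj y z then 1 else 0)"

definition bose_mesner :: "('v \<Rightarrow> 'v \<Rightarrow> bool) \<Rightarrow> (complex ^ 'v ^ 'v::finite) set" where
  "bose_mesner adj = gen_alg {adjacency_matrix adj}"

text \<open>$E_0,\dots,E_d$ is an enumeration of the primitive idempotents of the Bose-Mesner algebra,
  with $E_0 = |X|^{-1}J$.\<close>

definition primitive_idempotent_ordering ::
    "('v \<Rightarrow> 'v \<Rightarrow> bool) \<Rightarrow> nat \<Rightarrow> (nat \<Rightarrow> complex ^ 'v ^ 'v::finite) \<Rightarrow> bool" where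
  "primitive_idempotent_ordering adj d E \<longleftrightarrow>
     bij_betw E {..d} {e. primitive_idempotent (bose_mesner adj) e} \<and>
     E 0 = (\<chi> y z. 1 / of_nat CARD('v))"

definition mscale :: "complex \<Rightarrow> complex ^ 'v ^ 'v \<Rightarrow> complex ^ 'v ^ 'v::finite" where
  "mscale c B = (\<chi> y z. c * B $ y $ z)"

text \<open>\<open>kp h i j\<close> is the Krein parameter $q^h_{ij}$.\<close>

definition Q_polynomial :: "nat \<Rightarrow> (nat \<Rightarrow> complex ^ 'v ^ 'v::finite) \<Rightarrow> bool" where
  "Q_polynomial d E \<longleftrightarrow> (\<exists>kp :: nat \<Rightarrow> nat \<Rightarrow> nat \<Rightarrow> complex.
     (\<forall>i\<le>d. \<forall>j\<le>d. (\<chi> y z. E i $ y $ z * E j $ y $ z) =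
        mscale (1 / of_nat CARD('v)) (\<Sum>h\<le>d. mscale (kp h i j) (E h))) \<and>
     (\<forall>h\<le>d. \<forall>i\<le>d. \<forall>j\<le>d.
        (h > i + j \<or> i > h + j \<or> j > h + i \<longrightarrow> kp h i j = 0) \<and>
        (h = i + j \<or> i = h + j \<or> j = h + i \<longrightarrow> kp h i j \<noteq> 0)))"


section \<open>Terwilliger algebra\<close>

definition dual_adjacency :: "(nat \<Rightarrow> complex ^ 'v ^ 'v::finite) \<Rightarrow> 'v \<Rightarrow> complex ^ 'v ^ 'v" where
  "dual_adjacency E x = (\<chi> y z. if y = z then of_nat CARD('v) * E 1 $ x $ z else 0)"

definition dual_idempotent :: "('v \<Rightarrow> 'v \<Rightarrow> bool) \<Rightarrow> 'v \<Rightarrow> nat \<Rightarrow> complex ^ 'v ^ 'v::finite" where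
  "dual_idempotent adj x i = (\<chi> y z. if y = z \<and> gdist adj x z = i then 1 else 0)"

definition terwilliger_algebra ::
    "('v \<Rightarrow> 'v \<Rightarrow> bool) \<Rightarrow> (nat \<Rightarrow> complex ^ 'v ^ 'v::finite) \<Rightarrow> 'v \<Rightarrow> (complex ^ 'v ^ 'v) set" where
  "terwilliger_algebra adj E x = gen_alg {adjacency_matrix adj, dual_adjacency E x}"

definition alg_module :: "(complex ^ 'v ^ 'v::finite) set \<Rightarrow> (complex ^ 'v) set \<Rightarrow> bool" where
  "alg_module T W \<longleftrightarrow> vec.subspace W \<and> (\<forall>B\<in>T. \<forall>w\<in>W. B *v w \<in> W)"

definition irreducible_module :: "(complex ^ 'v ^ 'v::finite) set \<Rightarrow> (complex ^ 'v) set \<Rightarrow> bool" where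
  "irreducible_module T W \<longleftrightarrow> alg_module T W \<and> W \<noteq> {0} \<and>
     (\<forall>U. alg_module T U \<and> U \<subseteq> W \<longrightarrow> U = {0} \<or> U = W)"

text \<open>In the next two definitions \<open>F\<close> is either the sequence $E^*_0,\dots,E^*_d$ or the
  sequence $E_0,\dots,E_d$.\<close>

definition module_support ::
    "nat \<Rightarrow> (nat \<Rightarrow> complex ^ 'v ^ 'v::finite) \<Rightarrow> (complex ^ 'v) set \<Rightarrow> nat set" where
  "module_support d F W = {i. i \<le> d \<and> (\<lambda>w. F i *v w) ` W \<noteq> {0}}"

definition endpoint_wrt ::
    "nat \<Rightarrow> (nat \<Rightarrow> complex ^ 'v ^ 'v::finite) \<Rightarrow> (complex ^ 'v) set \<Rightarrow> nat" where
  "endpoint_wrt d F W = Min (module_support d F W)"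

definition thin_module ::
    "('v \<Rightarrow> 'v \<Rightarrow> bool) \<Rightarrow> nat \<Rightarrow> 'v \<Rightarrow> (complex ^ 'v::finite) set \<Rightarrow> bool" where
  "thin_module adj d x W \<longleftrightarrow>
     (\<forall>i\<le>d. vec.dim ((\<lambda>w. dual_idempotent adj x i *v w) ` W) \<le> 1)"

definition endpoint ::
    "('v \<Rightarrow> 'v \<Rightarrow> bool) \<Rightarrow> nat \<Rightarrow> 'v \<Rightarrow> (complex ^ 'v::finite) set \<Rightarrow> nat" where
  "endpoint adj d x W = endpoint_wrt d (dual_idempotent adj x) W"

definition dual_endpoint ::
    "nat \<Rightarrow> (nat \<Rightarrow> complex ^ 'v ^ 'v::finite) \<Rightarrow> (complex ^ 'v) set \<Rightarrow> nat" where
  "dual_endpoint d E W = endpoint_wrt d E W"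

definition module_diameter ::
    "('v \<Rightarrow> 'v \<Rightarrow> bool) \<Rightarrow> nat \<Rightarrow> 'v \<Rightarrow> (complex ^ 'v::finite) set \<Rightarrow> nat" where
  "module_diameter adj d x W = card (module_support d (dual_idempotent adj x) W) - 1"

definition primary_module :: "('v \<Rightarrow> 'v \<Rightarrow> bool) \<Rightarrow> 'v \<Rightarrow> (complex ^ 'v::finite) set" where
  "primary_module adj x = {B *v axis x 1 | B. B \<in> bose_mesner adj}"

definition cinner :: "complex ^ 'v \<Rightarrow> complex ^ 'v::finite \<Rightarrow> complex" where
  "cinner u v = (\<Sum>y\<in>UNIV. u $ y * cnj (v $ y))"

definition orth_complement_in ::
    "(complex ^ 'v::finite) set \<Rightarrow> (complex ^ 'v) set \<Rightarrow> (complex ^ 'v) set" where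
  "orth_complement_in W U = {w \<in> W. \<forall>u\<in>U. cinner w u = 0}"


section \<open>Delsarte cliques\<close>

definition delsarte_clique ::
    "('v \<Rightarrow> 'v \<Rightarrow> bool) \<Rightarrow> (nat \<Rightarrow> nat \<Rightarrow> nat \<Rightarrow> nat) \<Rightarrow> real \<Rightarrow> 'v::finite set \<Rightarrow> bool" where
  "delsarte_clique adj p \<theta>min C \<longleftrightarrow> C \<noteq> {} \<and> (\<forall>y\<in>C. \<forall>z\<in>C. y \<noteq> z \<longrightarrow> adj y z) \<and>
     real (card C) = 1 - real (valency p) / \<theta>min"

definition set_dist :: "('v \<Rightarrow> 'v \<Rightarrow> bool) \<Rightarrow> 'v \<Rightarrow> 'v::finite set \<Rightarrow> nat" where
  "set_dist adj y C = Min (gdist adj y ` C)"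

definition cell :: "('v \<Rightarrow> 'v \<Rightarrow> bool) \<Rightarrow> 'v::finite set \<Rightarrow> nat \<Rightarrow> 'v set" where
  "cell adj C i = {y. set_dist adj y C = i}"

definition cell_minus :: "('v \<Rightarrow> 'v \<Rightarrow> bool) \<Rightarrow> 'v::finite set \<Rightarrow> 'v \<Rightarrow> nat \<Rightarrow> 'v set" where
  "cell_minus adj C x i = cell adj C i \<inter> gsphere adj i x"

definition cell_plus :: "('v \<Rightarrow> 'v \<Rightarrow> bool) \<Rightarrow> 'v::finite set \<Rightarrow> 'v \<Rightarrow> nat \<Rightarrow> 'v set" where
  "cell_plus adj C x i = cell adj C i \<inter> gsphere adj (i + 1) x"

definition char_vec :: "'v set \<Rightarrow> complex ^ 'v::finite" where
  "char_vec Y = (\<chi> y. if y \<in> Y then 1 else 0)"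

definition clique_module ::
    "('v \<Rightarrow> 'v \<Rightarrow> bool) \<Rightarrow> nat \<Rightarrow> 'v::finite set \<Rightarrow> 'v \<Rightarrow> (complex ^ 'v) set" where
  "clique_module adj d C x = vec.span
     ({char_vec (cell_minus adj C x i) | i. i \<le> d - 1} \<union>
      {char_vec (cell_plus adj C x i) | i. i \<le> d - 1})"


section \<open>Leonard systems\<close>

text \<open>The underlying vector space is a subspace \<open>V\<close> of \<open>complex ^ 'v\<close>, and the linear maps on \<open>V\<close> are
  the restrictions to \<open>V\<close> of matrices leaving \<open>V\<close> invariant. All conditions only concern these
  restrictions.\<close>

definition eigenvalues_on :: "(complex ^ 'v::finite) set \<Rightarrow> complex ^ 'v ^ 'v \<Rightarrow> complex set" where
  "eigenvalues_on V B = {\<mu>. \<exists>v\<in>V. v \<noteq> 0 \<and> B *v v = \<mu> *s v}"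

text \<open>When \<open>B\<close> has $n+1 = \dim V$ distinct eigenvalues on \<open>V\<close>, the space is the direct sum of its
  eigenspaces, so the last condition determines each \<open>F i\<close> on \<open>V\<close>.\<close>

definition spectral_ordering ::
    "(complex ^ 'v::finite) set \<Rightarrow> nat \<Rightarrow> complex ^ 'v ^ 'v \<Rightarrow> (nat \<Rightarrow> complex ^ 'v ^ 'v) \<Rightarrow> bool" where
  "spectral_ordering V n B F \<longleftrightarrow> (\<exists>\<mu>. bij_betw \<mu> {..n} (eigenvalues_on V B) \<and>
     (\<forall>i\<le>n. \<forall>j\<le>n. \<forall>v\<in>V. B *v v = \<mu> j *s v \<longrightarrow> F i *v v = (if i = j then v else 0)))"

definition tridiagonal_wrt ::
    "(complex ^ 'v::finite) set \<Rightarrow> nat \<Rightarrow> complex ^ 'v ^ 'v \<Rightarrow> (nat \<Rightarrow> complex ^ 'v ^ 'v) \<Rightarrow> bool" where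
  "tridiagonal_wrt V n B F \<longleftrightarrow> (\<forall>i\<le>n. \<forall>j\<le>n.
     (\<bar>int i - int j\<bar> > 1 \<longrightarrow> (\<forall>v\<in>V. F i *v (B *v (F j *v v)) = 0)) \<and>
     (\<bar>int i - int j\<bar> = 1 \<longrightarrow> (\<exists>v\<in>V. F i *v (B *v (F j *v v)) \<noteq> 0)))"

definition leonard_system ::
    "(complex ^ 'v::finite) set \<Rightarrow> nat \<Rightarrow> complex ^ 'v ^ 'v \<Rightarrow> complex ^ 'v ^ 'v \<Rightarrow>
     (nat \<Rightarrow> complex ^ 'v ^ 'v) \<Rightarrow> (nat \<Rightarrow> complex ^ 'v ^ 'v) \<Rightarrow> bool" where
  "leonard_system V n B B' F F' \<longleftrightarrow>
     vec.subspace V \<and> vec.dim V = n + 1 \<and>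
     (\<forall>v\<in>V. B *v v \<in> V \<and> B' *v v \<in> V) \<and>
     spectral_ordering V n B F \<and> spectral_ordering V n B' F' \<and>
     tridiagonal_wrt V n B' F \<and> tridiagonal_wrt V n B F'"

definition eigenvalue_sequence ::
    "(complex ^ 'v::finite) set \<Rightarrow> nat \<Rightarrow> complex ^ 'v ^ 'v \<Rightarrow> (nat \<Rightarrow> complex ^ 'v ^ 'v) \<Rightarrow>
     (nat \<Rightarrow> complex) \<Rightarrow> bool" where
  "eigenvalue_sequence V n B F \<mu> \<longleftrightarrow>
     (\<forall>i\<le>n. \<forall>v\<in>V. B *v (F i *v v) = \<mu> i *s (F i *v v))"

text \<open>The representing matrix \<open>(m\<^sub>i\<^sub>j)\<close> of a map \<open>B\<close> with respect to a basis \<open>u\<close> is given by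
  $B u_j = \sum_i m_{ij} u_i$. Thus a subdiagonal of ones contributes $u_{j+1}$ to $B u_j$, and a
  superdiagonal entry $\varphi_j$ contributes $\varphi_j u_{j-1}$ to $B^* u_j$.\<close>

definition first_split_sequence ::
    "(complex ^ 'v::finite) set \<Rightarrow> nat \<Rightarrow> complex ^ 'v ^ 'v \<Rightarrow> complex ^ 'v ^ 'v \<Rightarrow>
     (nat \<Rightarrow> complex ^ 'v ^ 'v) \<Rightarrow> (nat \<Rightarrow> complex ^ 'v ^ 'v) \<Rightarrow> (nat \<Rightarrow> complex) \<Rightarrow> bool" where
  "first_split_sequence V n B B' F F' \<phi> \<longleftrightarrow> (\<forall>i\<in>{1..n}. \<phi> i \<noteq> 0) \<and>
     (\<exists>\<mu> \<mu>' u. eigenvalue_sequence V n B F \<mu> \<and> eigenvalue_sequence V n B' F' \<mu>' \<and>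
        inj_on u {..n} \<and> vec.independent (u ` {..n}) \<and> vec.span (u ` {..n}) = V \<and>
        (\<forall>j\<le>n. B *v u j = \<mu> j *s u j + (if j < n then u (j + 1) else 0)) \<and>
        (\<forall>j\<le>n. B' *v u j = \<mu>' j *s u j + (if 0 < j then \<phi> j *s u (j - 1) else 0)))"

definition leonard_system_with_parameter_array ::
    "(complex ^ 'v::finite) set \<Rightarrow> nat \<Rightarrow> complex ^ 'v ^ 'v \<Rightarrow> complex ^ 'v ^ 'v \<Rightarrow>
     (nat \<Rightarrow> complex ^ 'v ^ 'v) \<Rightarrow> (nat \<Rightarrow> complex ^ 'v ^ 'v) \<Rightarrow>
     (nat \<Rightarrow> complex) \<Rightarrow> (nat \<Rightarrow> complex) \<Rightarrow> (nat \<Rightarrow> complex) \<Rightarrow> (nat \<Rightarrow> complex) \<Rightarrow> bool" where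
  "leonard_system_with_parameter_array V n B B' F F' \<mu> \<mu>' \<phi> \<psi> \<longleftrightarrow>
     leonard_system V n B B' F F' \<and>
     eigenvalue_sequence V n B F \<mu> \<and> eigenvalue_sequence V n B' F' \<mu>' \<and>
     first_split_sequence V n B B' F F' \<phi> \<and>
     first_split_sequence V n B B' (\<lambda>i. F (n - i)) F' \<psi>"

text \<open>\<open>\<phi>\<close> and \<open>\<psi>\<close> are the first and second split sequences; \<open>h'\<close> and \<open>s'\<close> stand for $h^*$ and $s^*$.\<close>

definition q_racah_array ::
    "nat \<Rightarrow> complex \<Rightarrow> complex \<Rightarrow> complex \<Rightarrow> complex \<Rightarrow> complex \<Rightarrow> complex \<Rightarrow> complex \<Rightarrow>
     (nat \<Rightarrow> complex) \<Rightarrow> (nat \<Rightarrow> complex) \<Rightarrow> (nat \<Rightarrow> complex) \<Rightarrow> (nat \<Rightarrow> complex) \<Rightarrow> bool" where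
  "q_racah_array d q h h' s s' r1 r2 \<mu> \<mu>' \<phi> \<psi> \<longleftrightarrow>
     h \<noteq> 0 \<and> h' \<noteq> 0 \<and> s \<noteq> 0 \<and> s' \<noteq> 0 \<and> r1 \<noteq> 0 \<and> r2 \<noteq> 0 \<and>
     r1 * r2 = s * s' * q ^ (d + 1) \<and>
     (\<forall>i\<in>{1..d}. q ^ i \<noteq> 1 \<and> r1 * q ^ i \<noteq> 1 \<and> r2 * q ^ i \<noteq> 1 \<and>
        s' * q ^ i / r1 \<noteq> 1 \<and> s' * q ^ i / r2 \<noteq> 1) \<and>
     (\<forall>i\<in>{2..2 * d}. s * q ^ i \<noteq> 1 \<and> s' * q ^ i \<noteq> 1) \<and>
     (\<forall>i\<le>d. \<mu> i = \<mu> 0 + h * (1 - q ^ i) * (1 - s * q ^ (i + 1)) * q powi (- int i)) \<and>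
     (\<forall>i\<le>d. \<mu>' i = \<mu>' 0 + h' * (1 - q ^ i) * (1 - s' * q ^ (i + 1)) * q powi (- int i)) \<and>
     (\<forall>i\<in>{1..d}. \<phi> i = h * h' * q powi (1 - 2 * int i) * (1 - q ^ i) *
        (1 - q powi (int i - int d - 1)) * (1 - r1 * q ^ i) * (1 - r2 * q ^ i)) \<and>
     (\<forall>i\<in>{1..d}. \<psi> i = h * h' * q powi (1 - 2 * int i) * (1 - q ^ i) *
        (1 - q powi (int i - int d - 1)) * (r1 - s' * q ^ i) * (r2 - s' * q ^ i) / s')"

end

theory Submission
  imports Defs
begin

text \<open>
  Let $W$ be the span of the cells $\hat C_i^\pm$, let $\hat x$ and $\hat C$ be the characteristic
  vectors of the base vertex and of the clique, and let $U$ be the complement in $W$ of the primary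
  module $\mathcal M\hat x$. The Bose-Mesner algebra $\mathcal M$ consists of the matrices whose
  entries depend only on the distance (\<open>bose_mesner_iff_radial\<close>), and its primitive idempotents
  are real, symmetric and sum to the identity.

  The entries of $E_d$ alternate in sign with the distance (\<open>entry_least_alternating\<close>), and
  $E_d\hat C=0$ because $C$ attains Delsarte's bound. Together these say that for a vertex at
  distance $i$ from $C$ the number of nearest vertices of $C$ depends only on $i$
  (\<open>card_nearest\<close>), so that $C$ is completely regular, with covering radius less than $d$. It
  follows that $W=\mathcal M\hat x+\mathcal M\hat C$ (\<open>clique_module_decomposition\<close>). Hence $W$
  is invariant under $A$; it is invariant under $A^*$ because each cell lies in one sphere about $x$.
  As $A$ and $A^*$ preserve the primary module, and so do their adjoints, $U$ is a module too.

  The projection $u$ of $\hat C$ to $U$ is supported on the neighbours of $x$, and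
  $U=\mathcal Mu$ (\<open>U_cyclic\<close>). On each sphere $\Gamma_i(x)$ with $1\le i\le d-1$ there are the two
  nonempty cells $C_i^-$ and $C_{i-1}^+$, which leaves a line orthogonal to the primary module; on the
  spheres of radius $0$ and $d$ there is a single cell, which leaves nothing. This gives thinness,
  endpoint and diameter. Irreducibility holds because $U$ is generated over $\mathcal M$ by its
  line $E_1^*U$, which contains $u$ (\<open>irreducible_U\<close>). Finally $E_0U=0$, and $E_1u\ne0$ by a direct
  computation (\<open>E_clique_part_nonzero\<close>).
\<close>

section \<open>Hermitian inner product\<close>

lemma cinner_add_left: "cinner (u + v) w = cinner u w + cinner v w"
  by (simp add: cinner_def distrib_right sum.distrib)

lemma cinner_diff_left: "cinner (u - v) w = cinner u w - cinner v w"
  by (simp add: cinner_def left_diff_distrib sum_subtractf)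

lemma cinner_scale_left: "cinner (c *s u) w = c * cinner u w"
  by (simp add: cinner_def sum_distrib_left mult.assoc)

lemma cinner_zero [simp]: "cinner 0 w = 0" "cinner w 0 = 0"
  by (simp_all add: cinner_def)

lemma cinner_sum_left: "cinner (\<Sum>i\<in>I. u i) w = (\<Sum>i\<in>I. cinner (u i) w)"
  by (induction I rule: infinite_finite_induct) (simp_all add: cinner_add_left)

lemma cinner_commute: "cinner u v = cnj (cinner v u)"
  by (simp add: cinner_def mult.commute)

lemma cinner_self: "cinner u u = of_real (\<Sum>y\<in>UNIV. (cmod (u $ y))\<^sup>2)"
  by (simp add: cinner_def complex_norm_square of_real_sum del: of_real_power)

lemma cinner_self_eq_0_iff [simp]: "cinner u u = 0 \<longleftrightarrow> u = 0"
  unfolding cinner_self of_real_eq_0_iff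
  by (subst sum_nonneg_eq_0_iff) (auto simp: vec_eq_iff)

lemma Re_cinner_self_nonneg: "Re (cinner u u) \<ge> 0"
  unfolding cinner_self by (simp add: sum_nonneg)

text \<open>The entrywise complex conjugate. It is the adjoint of a symmetric matrix.\<close>

definition mat_cnj :: "complex ^ 'v ^ 'v \<Rightarrow> complex ^ 'v ^ 'v::finite" where
  "mat_cnj B = (\<chi> y z. cnj (B $ y $ z))"

lemma cinner_symmetric_matrix:
  assumes "\<And>y z. B $ y $ z = B $ z $ y"
  shows "cinner (B *v u) w = cinner u (mat_cnj B *v w)"
proof -
  have "cinner (B *v u) w = (\<Sum>y\<in>UNIV. \<Sum>z\<in>UNIV. B $ y $ z * u $ z * cnj (w $ y))"
    by (simp add: cinner_def matrix_vector_mult_def sum_distrib_right)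
  also have "\<dots> = (\<Sum>z\<in>UNIV. \<Sum>y\<in>UNIV. B $ y $ z * u $ z * cnj (w $ y))"
    by (rule sum.swap)
  also have "\<dots> = cinner u (mat_cnj B *v w)"
    using assms by (simp add: cinner_def matrix_vector_mult_def mat_cnj_def sum_distrib_left ac_simps)
  finally show ?thesis .
qed

section \<open>Matrices and generated algebras\<close>

lemma mscale_mult_left: "mscale c B ** D = mscale c (B ** D)"
  by (simp add: mscale_def matrix_matrix_mult_def vec_eq_iff sum_distrib_left mult.assoc)

lemma mscale_mult_right: "B ** mscale c D = mscale c (B ** D)"
  by (simp add: mscale_def matrix_matrix_mult_def vec_eq_iff sum_distrib_left ac_simps)

lemma mscale_vec: "mscale c B *v u = c *s (B *v u)"
  by (simp add: mscale_def matrix_vector_mult_def vec_eq_iff sum_distrib_left mult.assoc)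

lemma matrix_mult_0 [simp]: "B ** 0 = 0" "0 ** B = (0 :: complex ^ 'v ^ 'v::finite)"
  by (simp_all add: matrix_matrix_mult_def vec_eq_iff)

lemma mscale_0 [simp]: "mscale 0 B = 0" "mscale c 0 = 0" "mscale 1 B = B"
  by (simp_all add: mscale_def vec_eq_iff)

lemma matrix_add_mult: "(B + F) ** D = B ** D + F ** (D :: complex ^ 'v ^ 'v::finite)"
  by (simp add: matrix_matrix_mult_def vec_eq_iff distrib_right sum.distrib)

lemma matrix_sum_mult: "(\<Sum>i\<in>I. B i) ** D = (\<Sum>i\<in>I. B i ** (D :: complex ^ 'v ^ 'v::finite))"
  by (induction I rule: infinite_finite_induct) (simp_all add: matrix_add_mult)

lemma matrix_mult_sum: "D ** (\<Sum>i\<in>I. B i) = (\<Sum>i\<in>I. D ** (B i :: complex ^ 'v ^ 'v::finite))"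
  by (induction I rule: infinite_finite_induct) (simp_all add: matrix_add_ldistrib)

lemma matrix_sum_vec: "(\<Sum>i\<in>I. B i) *v u = (\<Sum>i\<in>I. (B i :: complex ^ 'v ^ 'v::finite) *v u)"
  by (induction I rule: infinite_finite_induct) (simp_all add: matrix_vector_mult_add_rdistrib)

lemma matrix_diff_mult: "(B - F) ** D = B ** D - F ** (D :: complex ^ 'v ^ 'v::finite)"
  by (simp add: matrix_matrix_mult_def vec_eq_iff left_diff_distrib sum_subtractf)

lemma matrix_mult_diff: "D ** (B - F) = D ** B - D ** (F :: complex ^ 'v ^ 'v::finite)"
  by (simp add: matrix_matrix_mult_def vec_eq_iff right_diff_distrib sum_subtractf)

lemma mscale_mscale: "mscale a (mscale b B) = mscale (a * b) B"
  by (simp add: mscale_def vec_eq_iff mult.assoc)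

lemma mscale_cancel: "mscale a B = mscale b B \<longleftrightarrow> a = b \<or> B = 0"
  by (auto simp: mscale_def vec_eq_iff)

lemma mat_mult_eq_mscale: "mat c ** B = mscale c B"
  by (simp add: mscale_def mat_def matrix_matrix_mult_def vec_eq_iff if_distrib[of "\<lambda>t. t * _"] cong: if_cong)

lemma mat_cnj_mult: "mat_cnj (B ** D) = mat_cnj B ** mat_cnj D"
  by (simp add: mat_cnj_def matrix_matrix_mult_def vec_eq_iff)

lemma mat_cnj_mat_cnj [simp]: "mat_cnj (mat_cnj B) = B"
  by (simp add: mat_cnj_def vec_eq_iff)

lemma mat_cnj_mscale: "mat_cnj (mscale c B) = mscale (cnj c) (mat_cnj B)"
  by (simp add: mat_cnj_def mscale_def vec_eq_iff)

lemma mat_vec: "mat c *v u = c *s (u :: complex ^ 'v::finite)"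
  by (simp add: mat_def matrix_vector_mult_def vec_eq_iff if_distrib[of "\<lambda>t. t * _"] cong: if_cong)

lemma char_vec_nth: "char_vec Y $ y = (if y \<in> Y then 1 else 0)"
  by (simp add: char_vec_def)

lemma axis_nth_if: "axis x a $ y = (if y = x then a else 0)"
  by (simp add: axis_def)

lemma gen_alg_mscale: "B \<in> gen_alg S \<Longrightarrow> mscale c B \<in> gen_alg S"
  by (metis gen_alg.scalar gen_alg.times mat_mult_eq_mscale)

lemma gen_alg_0: "0 \<in> gen_alg S"
  using gen_alg.scalar[of 0] by simp

lemma gen_alg_sum: "(\<And>i. i \<in> I \<Longrightarrow> B i \<in> gen_alg S) \<Longrightarrow> sum B I \<in> gen_alg S"
  by (induction I rule: infinite_finite_induct) (auto intro: gen_alg.plus gen_alg_0)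

lemma alg_module_gen_alg:
  assumes "vec.subspace W" "\<And>B w. B \<in> S \<Longrightarrow> w \<in> W \<Longrightarrow> B *v w \<in> W"
  shows "alg_module (gen_alg S) W"
proof -
  have "B *v w \<in> W" if "B \<in> gen_alg S" "w \<in> W" for B w
    using that
  proof (induction arbitrary: w rule: gen_alg.induct)
    case (scalar c) then show ?case using assms(1) by (simp add: mat_vec vec.subspace_scale)
  next
    case (generator B) then show ?case using assms(2) by blast
  next
    case (plus B D)
    then show ?case using assms(1) by (simp add: matrix_vector_mult_add_rdistrib vec.subspace_add)
  next
    case (times B D) then show ?case by (simp flip: matrix_vector_mul_assoc)
  qed
  then show ?thesis using assms(1) by (simp add: alg_module_def)
qed

lemma gen_alg_mono: "B \<in> gen_alg S \<Longrightarrow> S \<subseteq> T \<Longrightarrow> B \<in> gen_alg T"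
  by (induction rule: gen_alg.induct) (auto intro: gen_alg.intros)

section \<open>Distances in a graph\<close>

lemma relpowp_sym:
  assumes "symp r" "(r ^^ n) y z"
  shows "(r ^^ n) z y"
  using assms(2)
proof (induction n arbitrary: z)
  case (Suc n)
  then obtain w where w: "(r ^^ n) y w" "r w z" by auto
  then have "r z w" using assms(1) by (auto dest: sympD)
  then show ?case using Suc.IH[OF w(1)] by (rule relpowp_Suc_I2)
qed auto

text \<open>A distance-regular graph with diameter \<open>d\<close> and intersection numbers \<open>p\<close>.\<close>

locale drg =
  fixes adj :: "'v::finite \<Rightarrow> 'v \<Rightarrow> bool"
    and d :: nat
    and p :: "nat \<Rightarrow> nat \<Rightarrow> nat \<Rightarrow> nat"
  assumes connected: "connected_simple_graph adj"
    and diam: "d = gdiam adj"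
    and regular: "distance_regular adj p"
begin

abbreviation path_dist :: "'v \<Rightarrow> 'v \<Rightarrow> nat" (\<open>\<partial>\<close>) where
  "\<partial> \<equiv> gdist adj"

abbreviation A :: "complex ^ 'v ^ 'v" where
  "A \<equiv> adjacency_matrix adj"

lemma relpowp_gdist: "(adj ^^ \<partial> y z) y z"
proof -
  have "\<exists>n. (adj ^^ n) y z"
    using connected by (auto simp: connected_simple_graph_def intro: rtranclp_imp_relpowp)
  then show ?thesis unfolding gdist_def by (rule LeastI_ex)
qed

lemma gdist_le: "(adj ^^ n) y z \<Longrightarrow> \<partial> y z \<le> n"
  unfolding gdist_def by (rule Least_le)

lemma gdist_eq_0_iff [simp]: "\<partial> y z = 0 \<longleftrightarrow> y = z"
proof
  show "y = z" if "\<partial> y z = 0"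
    using relpowp_gdist[of y z] unfolding that by simp
  show "\<partial> y z = 0" if "y = z"
    using gdist_le[of 0 y z] that by simp
qed

lemma gdist_self [simp]: "\<partial> y y = 0"
  by simp

lemma gdist_commute: "\<partial> y z = \<partial> z y"
proof -
  have le: "\<partial> y z \<le> \<partial> z y" for y z
    using relpowp_sym[OF _ relpowp_gdist] connected
    by (intro gdist_le) (simp add: connected_simple_graph_def)
  show ?thesis by (rule le_antisym[OF le le])
qed

lemma gdist_triangle: "\<partial> y z \<le> \<partial> y w + \<partial> w z"
  by (rule gdist_le) (auto simp: relpowp_add intro: relpowp_gdist)

lemma adj_sym: "adj y z \<longleftrightarrow> adj z y"
  using connected by (auto simp: connected_simple_graph_def dest: sympD)

lemma gdist_eq_1_iff: "\<partial> y z = 1 \<longleftrightarrow> adj y z"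
proof
  assume "\<partial> y z = 1"
  then show "adj y z" using relpowp_gdist[of y z] by (simp add: eq_OO)
next
  assume "adj y z"
  then have "\<partial> y z \<le> 1" by (intro gdist_le) (simp add: eq_OO)
  moreover have "y \<noteq> z" using \<open>adj y z\<close> connected by (auto simp: connected_simple_graph_def irreflp_def)
  ultimately show "\<partial> y z = 1" by (metis gdist_eq_0_iff less_one nat_less_le)
qed

lemma gdist_eq_Suc_0_iff [simp]: "\<partial> y z = Suc 0 \<longleftrightarrow> adj y z"
  using gdist_eq_1_iff[of y z] by simp

lemma gdist_eq_Suc_0 [simp]: "adj y z \<Longrightarrow> \<partial> y z = Suc 0"
  by (simp only: gdist_eq_Suc_0_iff)

lemma gdist_adj:
  assumes "adj y z"
  shows "\<partial> w y \<le> \<partial> w z + 1" "\<partial> w z \<le> \<partial> w y + 1" "\<partial> y w \<le> \<partial> z w + 1" "\<partial> z w \<le> \<partial> y w + 1"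
  using gdist_eq_Suc_0[OF assms] gdist_triangle[of w y z] gdist_triangle[of w z y]
    gdist_commute[of y z] gdist_commute[of y w] gdist_commute[of z w]
  by simp_all

lemma gdist_Suc_neighbour:
  assumes "\<partial> y z = Suc n"
  obtains w where "adj y w" "\<partial> w z = n"
proof -
  have "(adj ^^ Suc n) y z" using relpowp_gdist[of y z] assms by simp
  then obtain w where w: "adj y w" "(adj ^^ n) w z" by (rule relpowp_Suc_E2)
  have "\<partial> w z = n" using gdist_le[OF w(2)] gdist_adj(3)[OF w(1), of z] assms by simp
  with w(1) show ?thesis by (rule that)
qed

lemma gdist_geodesic:
  assumes "i \<le> \<partial> y z"
  obtains w where "\<partial> w z = i" "\<partial> y w = \<partial> y z - i"
proof -
  have "\<exists>w. \<partial> w z = \<partial> y z - j \<and> \<partial> y w = j" if "j \<le> \<partial> y z" for j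
    using that
  proof (induction j)
    case 0 then show ?case by (metis diff_zero gdist_eq_0_iff)
  next
    case (Suc j)
    then obtain w where w: "\<partial> w z = \<partial> y z - j" "\<partial> y w = j" by auto
    then have "\<partial> w z = Suc (\<partial> y z - Suc j)" using Suc.prems by simp
    then obtain v where v: "adj w v" "\<partial> v z = \<partial> y z - Suc j" by (rule gdist_Suc_neighbour)
    have "\<partial> y v \<le> Suc j" using gdist_adj(2)[OF v(1), of y] w by simp
    moreover have "\<partial> y z \<le> \<partial> y v + \<partial> v z" by (rule gdist_triangle)
    ultimately show ?case using v Suc.prems by (intro exI[of _ v]) simp
  qed
  from this[of "\<partial> y z - i"] assms that show ?thesis by (metis diff_diff_cancel diff_le_self)
qed

lemma gdist_le_diam: "\<partial> y z \<le> d"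
  unfolding diam gdiam_def
proof (rule Max_ge)
  have "{\<partial> y z |y z. True} = (\<lambda>(y, z). \<partial> y z) ` UNIV" by auto
  then show "finite {\<partial> y z |y z. True}" by simp
qed auto

lemma card_spheres: "card (gsphere adj i y \<inter> gsphere adj j z) = p (\<partial> y z) i j"
  using regular by (simp add: distance_regular_def)

text \<open>A distance-regular graph has the same diameter seen from each vertex, since \<open>p 0 d d\<close> counts the
  vertices at distance \<open>d\<close> from any of them.\<close>

lemma exists_at_distance:
  assumes "i \<le> d"
  obtains y where "\<partial> x y = i"
proof -
  have "{\<partial> y z |y z. True} = (\<lambda>(y, z). \<partial> y z) ` UNIV" by auto
  then have fin: "finite {\<partial> y z |y z. True}" by simp
  then have "Max {\<partial> y z |y z. True} \<in> {\<partial> y z |y z. True}" by (intro Max_in) auto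
  then obtain u v where uv: "\<partial> u v = d" unfolding diam gdiam_def by auto
  then have "v \<in> gsphere adj d u \<inter> gsphere adj d u" by (simp add: gsphere_def)
  then have "card (gsphere adj d u \<inter> gsphere adj d u) \<noteq> 0" by (metis card_eq_0_iff empty_iff finite)
  then have "card (gsphere adj d x \<inter> gsphere adj d x) \<noteq> 0"
    by (simp only: card_spheres) (metis gdist_eq_0_iff)
  then obtain w where w: "\<partial> x w = d" by (auto simp: gsphere_def)
  obtain y where "\<partial> y x = i"
    using gdist_geodesic[of i w x] assms w gdist_commute[of x w] by auto
  then show ?thesis using that gdist_commute by metis
qed

section \<open>The Bose-Mesner algebra\<close>

text \<open>The matrices whose entries depend only on the distance of the two indices, that is, the
  span of the distance matrices. They are shown to form the Bose-Mesner algebra.\<close>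

definition radial :: "complex ^ 'v ^ 'v \<Rightarrow> bool" where
  "radial B \<longleftrightarrow> (\<exists>f. \<forall>y z. B $ y $ z = f (\<partial> y z))"

text \<open>The distance matrix $A_i$; it vanishes for \<open>i\<close> larger than the diameter.\<close>

definition distance_matrix :: "nat \<Rightarrow> complex ^ 'v ^ 'v" where
  "distance_matrix i = (\<chi> y z. if \<partial> y z = i then 1 else 0)"

lemma radialI: "(\<And>y z. B $ y $ z = f (\<partial> y z)) \<Longrightarrow> radial B"
  by (auto simp: radial_def)

lemma radialE:
  assumes "radial B"
  obtains f where "\<And>y z. B $ y $ z = f (\<partial> y z)"
  using assms by (auto simp: radial_def)

lemma sum_by_distances:
  fixes f g :: "nat \<Rightarrow> complex"
  shows "(\<Sum>w\<in>UNIV. f (\<partial> y w) * g (\<partial> z w)) = (\<Sum>i\<le>d. \<Sum>j\<le>d. f i * g j * of_nat (p (\<partial> y z) i j))"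
proof -
  have "(\<Sum>w\<in>UNIV. f (\<partial> y w) * g (\<partial> z w)) =
      (\<Sum>w\<in>UNIV. \<Sum>i\<le>d. \<Sum>j\<le>d. if w \<in> gsphere adj i y \<inter> gsphere adj j z then f i * g j else 0)"
  proof (rule sum.cong[OF refl])
    fix w
    have "(\<Sum>i\<le>d. \<Sum>j\<le>d. if w \<in> gsphere adj i y \<inter> gsphere adj j z then f i * g j else 0)
       = (\<Sum>i\<le>d. if \<partial> y w = i then \<Sum>j\<le>d. if \<partial> z w = j then f i * g j else 0 else 0)"
      by (intro sum.cong) (auto simp: gsphere_def)
    also have "\<dots> = f (\<partial> y w) * g (\<partial> z w)" by (simp add: gdist_le_diam)
    finally show "f (\<partial> y w) * g (\<partial> z w) =
      (\<Sum>i\<le>d. \<Sum>j\<le>d. if w \<in> gsphere adj i y \<inter> gsphere adj j z then f i * g j else 0)" by simp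
  qed
  also have "\<dots> = (\<Sum>i\<le>d. \<Sum>j\<le>d. \<Sum>w\<in>UNIV. if w \<in> gsphere adj i y \<inter> gsphere adj j z then f i * g j else 0)"
    by (subst sum.swap, intro sum.cong[OF refl], rule sum.swap)
  also have "\<dots> = (\<Sum>i\<le>d. \<Sum>j\<le>d. f i * g j * of_nat (p (\<partial> y z) i j))"
  proof (intro sum.cong[OF refl])
    fix i j
    have "(\<Sum>w\<in>UNIV. if w \<in> gsphere adj i y \<inter> gsphere adj j z then f i * g j else 0)
        = (\<Sum>w\<in>gsphere adj i y \<inter> gsphere adj j z. f i * g j)"
      by (subst sum.inter_filter[symmetric]) (auto simp: Int_def)
    then show "(\<Sum>w\<in>UNIV. if w \<in> gsphere adj i y \<inter> gsphere adj j z then f i * g j else 0)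
      = f i * g j * of_nat (p (\<partial> y z) i j)"
      by (simp add: card_spheres)
  qed
  finally show ?thesis .
qed

lemma radial_mult: "radial B \<Longrightarrow> radial D \<Longrightarrow> radial (B ** D)"
proof -
  assume "radial B" "radial D"
  then obtain f g where f: "\<And>y z. B $ y $ z = f (\<partial> y z)" and g: "\<And>y z. D $ y $ z = g (\<partial> y z)"
    by (metis radialE)
  show ?thesis
  proof (rule radialI)
    fix y z
    show "(B ** D) $ y $ z = (\<lambda>h. \<Sum>i\<le>d. \<Sum>j\<le>d. f i * g j * of_nat (p h i j)) (\<partial> y z)"
      using sum_by_distances[of f y g z]
      by (simp add: matrix_matrix_mult_def f g gdist_commute)
  qed
qed

lemma radial_commute:
  assumes "radial B" "radial D"
  shows "B ** D = D ** B"
proof -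
  obtain f g h where f: "\<And>y z. B $ y $ z = f (\<partial> y z)" and g: "\<And>y z. D $ y $ z = g (\<partial> y z)"
    and h: "\<And>y z. (B ** D) $ y $ z = h (\<partial> y z)"
    using assms radial_mult by (metis radialE)
  have "(D ** B) $ y $ z = (B ** D) $ z $ y" for y z
    by (simp add: matrix_matrix_mult_def f g mult.commute gdist_commute)
  then have "(D ** B) $ y $ z = (B ** D) $ y $ z" for y z
    using h gdist_commute[of z y] by simp
  then show ?thesis by (simp add: vec_eq_iff)
qed

lemma radial_mat: "radial (mat c)"
  by (rule radialI[of _ "\<lambda>n. if n = 0 then c else 0"]) (simp add: mat_def)

lemma radial_add: "radial B \<Longrightarrow> radial D \<Longrightarrow> radial (B + D)"
proof -
  assume "radial B" "radial D"
  then obtain f g where "\<And>y z. B $ y $ z = f (\<partial> y z)" "\<And>y z. D $ y $ z = g (\<partial> y z)"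
    by (metis radialE)
  then show ?thesis by (intro radialI[of _ "\<lambda>n. f n + g n"]) simp
qed

lemma adjacency_matrix_eq: "A = distance_matrix 1"
  by (simp add: adjacency_matrix_def distance_matrix_def)

lemma radial_distance_matrix: "radial (distance_matrix i)"
  by (rule radialI[of _ "\<lambda>n. if n = i then 1 else 0"]) (simp add: distance_matrix_def)

text \<open>In the product of $A$ and $A_j$ the highest distance matrix that occurs is $A_{j+1}$, with the
  nonzero coefficient \<open>p (j + 1) 1 j\<close>. Hence $A_{j+1}$ is a polynomial in $A$ if $A_0,\dots,A_j$
  are.\<close>

lemma distance_matrix_in_bose_mesner: "distance_matrix i \<in> bose_mesner adj"
proof (induction i rule: less_induct)
  case (less i)
  show ?case
  proof (cases "i = 0 \<or> i > d")
    case True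
    then show ?thesis
    proof
      assume "i = 0"
      then have "distance_matrix i = mat 1" by (simp add: distance_matrix_def mat_def)
      then show ?thesis by (simp add: bose_mesner_def gen_alg.scalar)
    next
      assume "i > d"
      then have "distance_matrix i = 0"
        using gdist_le_diam by (auto simp: distance_matrix_def vec_eq_iff) (metis not_less)
      then show ?thesis by (simp add: bose_mesner_def gen_alg_0)
    qed
  next
    case False
    then obtain j where j: "i = Suc j" and id: "i \<le> d" by (metis not_less old.nat.exhaust)
    have entry: "(A ** distance_matrix j) $ y $ z = of_nat (p (\<partial> y z) 1 j)" for y z
    proof -
      have "(A ** distance_matrix j) $ y $ z = of_nat (card (gsphere adj 1 y \<inter> gsphere adj j z))"
        by (simp add: matrix_matrix_mult_def adjacency_matrix_def distance_matrix_def
          gsphere_def gdist_commute[of z] if_distrib[of "\<lambda>t. t * _"] sum.If_cases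
          Int_def cong: if_cong)
      then show ?thesis by (simp add: card_spheres)
    qed
    obtain u v where uv: "\<partial> u v = i" using exists_at_distance[OF id] by blast
    obtain w where w: "adj u w" "\<partial> w v = j" using gdist_Suc_neighbour uv j by metis
    have "w \<in> gsphere adj 1 u \<inter> gsphere adj j v"
      using w gdist_commute[of v w] gdist_eq_1_iff[of u w] by (simp add: gsphere_def)
    then have c: "p i 1 j \<noteq> 0"
      using card_spheres[of 1 u j v] uv by (metis card_eq_0_iff empty_iff finite)
    have zero: "p (\<partial> y z) 1 j = 0" if "\<partial> y z > i" for y z
    proof -
      have "gsphere adj 1 y \<inter> gsphere adj j z = {}"
      proof (rule ccontr)
        assume "\<not> ?thesis"
        then obtain w where "\<partial> y w = 1" "\<partial> z w = j" by (auto simp: gsphere_def)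
        then show False using that j gdist_triangle[of y z w] gdist_commute[of z w] by simp
      qed
      then show ?thesis using card_spheres[of 1 y j z] by simp
    qed
    have "distance_matrix i = mscale (1 / of_nat (p i 1 j))
       (A ** distance_matrix j + mscale (-1) (\<Sum>l<i. mscale (of_nat (p l 1 j)) (distance_matrix l)))"
    proof -
      have "of_nat (p i 1 j) * distance_matrix i $ y $ z =
        (A ** distance_matrix j) $ y $ z - (\<Sum>l<i. of_nat (p l 1 j) * distance_matrix l $ y $ z)" for y z
        unfolding entry using zero[of y z] 
        by (cases "\<partial> y z" i rule: linorder_cases) (auto simp: distance_matrix_def if_distrib[of "\<lambda>t. _ * t"] cong: if_cong)
      then show ?thesis using c
        by (simp add: vec_eq_iff mscale_def field_simps)
    qed
    also have "\<dots> \<in> bose_mesner adj"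
      using less.IH j unfolding bose_mesner_def
      by (intro gen_alg_mscale gen_alg.plus gen_alg.times gen_alg_sum) (auto intro: gen_alg.generator)
    finally show ?thesis .
  qed
qed

lemma bose_mesner_iff_radial: "B \<in> bose_mesner adj \<longleftrightarrow> radial B"
proof
  show "radial B" if "B \<in> bose_mesner adj"
    using that unfolding bose_mesner_def
    by (induction rule: gen_alg.induct)
      (auto intro: radial_mat radial_add radial_mult simp: adjacency_matrix_eq radial_distance_matrix)
next
  assume "radial B"
  then obtain f where f: "\<And>y z. B $ y $ z = f (\<partial> y z)" by (metis radialE)
  have "B = (\<Sum>i\<le>d. mscale (f i) (distance_matrix i))"
    by (simp add: vec_eq_iff f mscale_def distance_matrix_def gdist_le_diam if_distrib[of "\<lambda>t. _ * t"] cong: if_cong)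
  also have "\<dots> \<in> bose_mesner adj"
    using distance_matrix_in_bose_mesner unfolding bose_mesner_def
    by (intro gen_alg_sum gen_alg_mscale)
  finally show "B \<in> bose_mesner adj" .
qed

lemma radial_sum: "(\<And>i. i \<in> I \<Longrightarrow> radial (B i)) \<Longrightarrow> radial (sum B I)"
  using gen_alg_sum[of I B "{A}"] by (simp add: bose_mesner_iff_radial[symmetric] bose_mesner_def)

lemma radial_mscale: "radial B \<Longrightarrow> radial (mscale c B)"
  using gen_alg_mscale[of B "{A}"] by (simp add: bose_mesner_iff_radial[symmetric] bose_mesner_def)

lemma radial_diff: "radial B \<Longrightarrow> radial D \<Longrightarrow> radial (B - D)"
proof -
  assume "radial B" "radial D"
  then have "radial (B + mscale (-1) D)" by (intro radial_add radial_mscale)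
  moreover have "B + mscale (-1) D = B - D" by (simp add: mscale_def vec_eq_iff)
  ultimately show ?thesis by simp
qed

lemma radial_A: "radial A"
  by (simp add: adjacency_matrix_eq radial_distance_matrix)

lemma radial_symmetric: "radial B \<Longrightarrow> B $ y $ z = B $ z $ y"
  by (metis radialE gdist_commute)

lemma radial_mat_cnj: "radial B \<Longrightarrow> radial (mat_cnj B)"
proof -
  assume "radial B"
  then obtain f where "\<And>y z. B $ y $ z = f (\<partial> y z)" by (metis radialE)
  then show ?thesis by (intro radialI[of _ "\<lambda>n. cnj (f n)"]) (simp add: mat_cnj_def)
qed

lemma cinner_radial: "radial B \<Longrightarrow> cinner (B *v u) w = cinner u (mat_cnj B *v w)"
  by (rule cinner_symmetric_matrix) (rule radial_symmetric)

end

section \<open>Primitive idempotents\<close>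

text \<open>A distance-regular graph together with the primitive idempotents \<open>E i\<close> of its Bose-Mesner
  algebra, ordered such that the eigenvalues \<open>\<theta> i\<close> of the adjacency matrix decrease.\<close>

locale drg_spectrum = drg adj d p
  for adj :: "'v::finite \<Rightarrow> 'v \<Rightarrow> bool" and d p +
  fixes E :: "nat \<Rightarrow> complex ^ 'v ^ 'v"
    and \<theta> :: "nat \<Rightarrow> real"
  assumes ordering: "primitive_idempotent_ordering adj d E"
    and spectral: "A = (\<Sum>i\<le>d. mscale (of_real (\<theta> i)) (E i))"
    and decreasing: "\<And>i j. i < j \<Longrightarrow> j \<le> d \<Longrightarrow> \<theta> i > \<theta> j"
begin

lemma E_primitive: "i \<le> d \<Longrightarrow> primitive_idempotent (bose_mesner adj) (E i)"
  using ordering by (auto simp: primitive_idempotent_ordering_def bij_betw_def)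

lemma E_radial: "i \<le> d \<Longrightarrow> radial (E i)"
  and E_nonzero: "i \<le> d \<Longrightarrow> E i \<noteq> 0"
  and E_idem: "i \<le> d \<Longrightarrow> E i ** E i = E i"
  using E_primitive
  by (auto simp: primitive_idempotent_def idempotent_in_def bose_mesner_iff_radial)

text \<open>In a commutative algebra, \<open>e = e ** f + (e - e ** f)\<close> splits \<open>e\<close> into orthogonal idempotents.\<close>

lemma primitive_absorbs:
  assumes e: "primitive_idempotent (bose_mesner adj) e" and f: "radial f" "f ** f = f"
  shows "e ** f = 0 \<or> e ** f = e"
proof (rule ccontr)
  assume neg: "\<not> ?thesis"
  have e': "radial e" "e ** e = e"
    using e by (auto simp: primitive_idempotent_def idempotent_in_def bose_mesner_iff_radial)
  define a where "a = e ** f"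
  have a: "radial a" unfolding a_def by (rule radial_mult[OF e'(1) f(1)])
  have ea: "e ** a = a" unfolding a_def by (simp add: matrix_mul_assoc e')
  have ae: "a ** e = a" using radial_commute[OF a e'(1)] ea by simp
  have "a ** f = a" unfolding a_def by (simp add: matrix_mul_assoc[symmetric] f)
  then have aa: "a ** a = a" by (metis a_def ae matrix_mul_assoc)
  have "idempotent_in (bose_mesner adj) a"
    using a aa neg by (simp add: idempotent_in_def bose_mesner_iff_radial a_def)
  moreover have "idempotent_in (bose_mesner adj) (e - a)"
    using a e' aa ae ea neg radial_diff[of e a]
    by (auto simp: idempotent_in_def bose_mesner_iff_radial matrix_diff_mult matrix_mult_diff a_def)
  moreover have "a ** (e - a) = 0" "(e - a) ** a = 0" "e = a + (e - a)"
    using aa ae ea by (simp_all add: matrix_diff_mult matrix_mult_diff)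
  ultimately show False using e unfolding primitive_idempotent_def by blast
qed

lemma E_orth:
  assumes "i \<le> d" "j \<le> d" "i \<noteq> j"
  shows "E i ** E j = 0"
proof (rule ccontr)
  assume "E i ** E j \<noteq> 0"
  then have "E i ** E j = E i" "E j ** E i = E j"
    using primitive_absorbs[OF E_primitive E_radial E_idem] radial_commute E_radial assms by metis+
  then have "E i = E j" using radial_commute E_radial assms by metis
  then show False
    using ordering assms by (auto simp: primitive_idempotent_ordering_def bij_betw_def dest: inj_onD)
qed

lemma E_mult: "i \<le> d \<Longrightarrow> j \<le> d \<Longrightarrow> E i ** E j = (if i = j then E i else 0)"
  by (simp add: E_orth E_idem)

lemma A_E:
  assumes "i \<le> d"
  shows "A ** E i = mscale (of_real (\<theta> i)) (E i)"
proof -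
  have "A ** E i = (\<Sum>j\<le>d. if j = i then mscale (of_real (\<theta> i)) (E i) else 0)"
    unfolding spectral matrix_sum_mult mscale_mult_left using assms
    by (intro sum.cong) (auto simp: E_mult)
  then show ?thesis using assms by simp
qed

text \<open>Otherwise the complement \<open>R\<close> of the sum would be a nonzero idempotent killed by \<open>A\<close>. The
  Bose-Mesner algebra then acts on \<open>R\<close> by scalars, so \<open>R\<close> would be a further primitive idempotent.\<close>

lemma E_sum: "(\<Sum>i\<le>d. E i) = mat 1"
proof (rule ccontr)
  define R where "R = mat 1 - (\<Sum>i\<le>d. E i)"
  assume "\<not> ?thesis"
  then have R0: "R \<noteq> 0" by (simp add: R_def)
  have R: "radial R" unfolding R_def by (intro radial_diff radial_mat radial_sum E_radial) simp
  have ER: "E i ** R = 0" if "i \<le> d" for i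
  proof -
    have "(\<Sum>j\<le>d. E i ** E j) = (\<Sum>j\<le>d. if j = i then E i else 0)"
      using that by (intro sum.cong) (auto simp: E_mult)
    then show ?thesis using that
      by (simp add: R_def matrix_mult_diff matrix_mult_sum)
  qed
  have RR: "R ** R = R"
    using ER by (subst (1) R_def) (simp add: matrix_diff_mult matrix_sum_mult)
  have AR: "A ** R = 0"
    unfolding spectral matrix_sum_mult mscale_mult_left by (simp add: ER)
  have scalar: "\<exists>c. B ** R = mscale c R" if "B \<in> bose_mesner adj" for B
    using that unfolding bose_mesner_def
  proof (induction rule: gen_alg.induct)
    case (scalar c) show ?case by (auto simp: mat_mult_eq_mscale)
  next
    case (generator B) then show ?case by (auto simp: AR intro: exI[of _ 0])
  next
    case (plus B D)
    then obtain b c where "B ** R = mscale b R" "D ** R = mscale c R" by auto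
    then have "(B + D) ** R = mscale (b + c) R"
      by (simp add: matrix_add_mult) (simp add: mscale_def vec_eq_iff distrib_right)
    then show ?case ..
  next
    case (times B D)
    then obtain b c where "B ** R = mscale b R" "D ** R = mscale c R" by auto
    then have "(B ** D) ** R = mscale (c * b) R"
      by (simp add: matrix_mul_assoc[symmetric] mscale_mult_right mscale_mscale)
    then show ?case ..
  qed
  have "primitive_idempotent (bose_mesner adj) R"
    unfolding primitive_idempotent_def
  proof (intro conjI notI)
    show "idempotent_in (bose_mesner adj) R"
      using R R0 RR by (simp add: idempotent_in_def bose_mesner_iff_radial)
    assume "\<exists>f g. idempotent_in (bose_mesner adj) f \<and> idempotent_in (bose_mesner adj) g \<and>
      f ** g = 0 \<and> g ** f = 0 \<and> R = f + g"
    then obtain f g where f: "f \<in> bose_mesner adj" "f \<noteq> 0" "f ** f = f" and g: "g \<noteq> 0"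
      and fg: "f ** g = 0" "R = f + g" by (auto simp: idempotent_in_def)
    have fR: "f ** R = f" using f fg by (simp add: matrix_add_ldistrib)
    obtain c where c: "f ** R = mscale c R" using scalar f(1) by blast
    then have fc: "f = mscale c R" using fR by simp
    have "mscale c R = mscale (c * c) R"
      using f(3) RR by (simp add: fc mscale_mult_left mscale_mult_right mscale_mscale)
    then have "c = 0 \<or> c = 1" using R0 by (simp add: mscale_cancel)
    then show False using c fR f(2) g fg(2) by auto
  qed
  then obtain i where "i \<le> d" "R = E i"
    using ordering by (auto simp: primitive_idempotent_ordering_def bij_betw_def)
  then show False using ER RR R0 by auto
qed

text \<open>The conjugate \<open>F\<close> of \<open>E i\<close> has the same real eigenvalue, and the eigenvalues are distinct.
  So \<open>F\<close> is killed by the other idempotents, which gives \<open>F = E i ** F\<close> and, conjugated,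
  \<open>E i = F ** E i\<close>.\<close>

lemma E_real:
  assumes i: "i \<le> d"
  shows "mat_cnj (E i) = E i"
proof -
  define F where "F = mat_cnj (E i)"
  have F: "radial F"
  proof -
    obtain f where "\<And>y z. E i $ y $ z = f (\<partial> y z)" using E_radial[OF i] by (metis radialE)
    then show ?thesis by (intro radialI[of _ "\<lambda>n. cnj (f n)"]) (simp add: F_def mat_cnj_def)
  qed
  have "mat_cnj A = A" by (simp add: adjacency_matrix_def mat_cnj_def vec_eq_iff)
  then have AF: "A ** F = mscale (of_real (\<theta> i)) F"
    using A_E[OF i] mat_cnj_mult[of A "E i"] by (simp add: F_def mat_cnj_mscale)
  have EF: "E j ** F = 0" if "j \<le> d" "j \<noteq> i" for j
  proof -
    have "mscale (of_real (\<theta> j)) (E j ** F) = A ** (E j ** F)"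
      using A_E[OF that(1)] by (simp add: matrix_mul_assoc mscale_mult_left)
    also have "\<dots> = E j ** (A ** F)"
      using radial_commute[OF radial_A E_radial[OF that(1)]] by (simp add: matrix_mul_assoc)
    also have "\<dots> = mscale (of_real (\<theta> i)) (E j ** F)"
      by (simp add: AF mscale_mult_right)
    finally have "\<theta> j = \<theta> i \<or> E j ** F = 0" by (simp add: mscale_cancel)
    then show ?thesis using decreasing[of i j] decreasing[of j i] that i by (cases i j rule: linorder_cases) auto
  qed
  have "F = (\<Sum>j\<le>d. E j) ** F" by (simp add: E_sum)
  also have "\<dots> = (\<Sum>j\<le>d. if j = i then E i ** F else 0)"
    unfolding matrix_sum_mult by (intro sum.cong) (auto simp: EF)
  also have "\<dots> = E i ** F" using i by simp
  finally have 1: "F = E i ** F" .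
  then have "E i = F ** E i" using mat_cnj_mult[of "E i" F] by (simp add: F_def)
  then show ?thesis using 1 radial_commute[OF F E_radial[OF i]] by (simp add: F_def)
qed

lemma cinner_E: "i \<le> d \<Longrightarrow> cinner (E i *v u) w = cinner u (E i *v w)"
  using cinner_symmetric_matrix[of "E i" u w] radial_symmetric[OF E_radial] by (simp add: E_real)

lemma cinner_E_self: "i \<le> d \<Longrightarrow> cinner (E i *v u) u = cinner (E i *v u) (E i *v u)"
  by (metis cinner_E E_idem matrix_vector_mul_assoc)

text \<open>Rayleigh's principle for the least eigenvalue, with the case of equality.\<close>

lemma least_eigenvalue_le:
  "\<theta> d * Re (cinner u u) \<le> Re (cinner (A *v u) u)"
  and least_eigenvalue_eq:
  "\<theta> d * Re (cinner u u) = Re (cinner (A *v u) u) \<Longrightarrow> A *v u = of_real (\<theta> d) *s u"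
proof -
  let ?n = "\<lambda>i. Re (cinner (E i *v u) (E i *v u))"
  have dec: "u = (\<Sum>i\<le>d. E i *v u)"
    by (simp add: E_sum matrix_sum_vec[symmetric])
  have "cinner u u = (\<Sum>i\<le>d. cinner (E i *v u) u)"
    by (subst (1) dec) (simp add: cinner_sum_left)
  then have 1: "Re (cinner u u) = (\<Sum>i\<le>d. ?n i)" by (simp add: cinner_E_self)
  have "cinner (A *v u) u = (\<Sum>i\<le>d. of_real (\<theta> i) * cinner (E i *v u) u)"
    by (simp add: spectral matrix_sum_vec cinner_sum_left mscale_vec cinner_scale_left)
  then have 2: "Re (cinner (A *v u) u) = (\<Sum>i\<le>d. \<theta> i * ?n i)" by (simp add: cinner_E_self)
  have diff: "Re (cinner (A *v u) u) - \<theta> d * Re (cinner u u) = (\<Sum>i\<le>d. (\<theta> i - \<theta> d) * ?n i)"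
    unfolding 1 2 by (simp add: sum_distrib_left sum_subtractf left_diff_distrib)
  have ge: "\<theta> i \<ge> \<theta> d" if "i \<le> d" for i
    using decreasing[of i d] that by (cases "i = d") auto
  have nonneg: "(\<theta> i - \<theta> d) * ?n i \<ge> 0" if "i \<le> d" for i
    using ge[OF that] Re_cinner_self_nonneg[of "E i *v u"] by (intro mult_nonneg_nonneg) simp_all
  then have "(\<Sum>i\<le>d. (\<theta> i - \<theta> d) * ?n i) \<ge> 0" by (intro sum_nonneg) simp
  then show "\<theta> d * Re (cinner u u) \<le> Re (cinner (A *v u) u)" using diff by simp
  assume "\<theta> d * Re (cinner u u) = Re (cinner (A *v u) u)"
  then have "(\<Sum>i\<le>d. (\<theta> i - \<theta> d) * ?n i) = 0" using diff by simp
  then have zero: "(\<theta> i - \<theta> d) * ?n i = 0" if "i \<le> d" for i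
    using that nonneg by (subst (asm) sum_nonneg_eq_0_iff) auto
  have E0: "E i *v u = 0" if "i < d" for i
  proof -
    have "?n i = 0" using zero[of i] decreasing[of i d] that by simp
    then have "cinner (E i *v u) (E i *v u) = 0" by (simp add: cinner_self)
    then show ?thesis by simp
  qed
  have "u = (\<Sum>i\<le>d. if i = d then E d *v u else 0)"
    by (subst (1) dec, intro sum.cong) (auto simp: E0)
  then have "u = E d *v u" by simp
  then show "A *v u = of_real (\<theta> d) *s u"
    by (metis A_E le_refl matrix_vector_mul_assoc mscale_vec)
qed

section \<open>Entries of the primitive idempotents\<close>

text \<open>\<open>entry i n\<close> is the common value of the entries of \<open>E i\<close> at distance \<open>n\<close>.\<close>

definition entry :: "nat \<Rightarrow> nat \<Rightarrow> real" where
  "entry i = (SOME s. \<forall>y z. E i $ y $ z = of_real (s (\<partial> y z)))"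

lemma E_entry:
  assumes "i \<le> d"
  shows "E i $ y $ z = of_real (entry i (\<partial> y z))"
proof -
  obtain f where f: "\<And>y z. E i $ y $ z = f (\<partial> y z)" using E_radial[OF assms] by (metis radialE)
  have "cnj (E i $ y $ z) = E i $ y $ z" for y z
    using E_real[OF assms] by (metis (no_types, lifting) mat_cnj_def vec_lambda_beta)
  then have "\<forall>y z. E i $ y $ z = of_real (Re (f (\<partial> y z)))"
    unfolding f by (metis Reals_cnj_iff of_real_Re)
  then have "\<exists>s. \<forall>y z. E i $ y $ z = of_real (s (\<partial> y z))" by (intro exI[of _ "\<lambda>n. Re (f n)"])
  then have "\<forall>y z. E i $ y $ z = of_real (entry i (\<partial> y z))"
    unfolding entry_def by (rule someI_ex)
  then show ?thesis by blast
qed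

text \<open>A diagonal entry of the real symmetric idempotent \<open>E i\<close> is the sum of the squares of a row.\<close>

lemma entry_0_pos:
  assumes i: "i \<le> d"
  shows "entry i 0 > 0"
proof -
  obtain u v where uv: "E i $ u $ v \<noteq> 0" using E_nonzero[OF i] by (auto simp: vec_eq_iff)
  have "E i $ u $ u = (E i ** E i) $ u $ u" using E_idem[OF i] by simp
  also have "\<dots> = (\<Sum>w\<in>UNIV. E i $ u $ w * E i $ w $ u)" by (simp add: matrix_matrix_mult_def)
  also have "\<dots> = of_real (\<Sum>w\<in>UNIV. (entry i (\<partial> u w))\<^sup>2)"
    by (simp add: E_entry[OF i] gdist_commute power2_eq_square)
  finally have "of_real (entry i 0) = (of_real (\<Sum>w\<in>UNIV. (entry i (\<partial> u w))\<^sup>2) :: complex)"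
    by (simp add: E_entry[OF i, of u u] del: of_real_sum)
  then have "entry i 0 = (\<Sum>w\<in>UNIV. (entry i (\<partial> u w))\<^sup>2)" by (simp only: of_real_eq_iff)
  also have "\<dots> > 0"
    using uv by (intro sum_pos2[of _ v]) (auto simp: E_entry[OF i])
  finally show ?thesis .
qed

lemma card_neighbours: "card {z. adj y z} = valency p"
proof -
  have "gsphere adj 1 y \<inter> gsphere adj 1 y = {z. adj y z}"
    by (auto simp: gsphere_def)
  then show ?thesis using card_spheres[of 1 y 1 y] gdist_eq_0_iff[of y y] by (simp add: valency_def)
qed

lemma A_vec: "(A *v u) $ y = (\<Sum>z | adj y z. u $ z)"
  by (simp add: matrix_vector_mult_def adjacency_matrix_def if_distrib[of "\<lambda>t. t * _"] sum.If_cases cong: if_cong)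

lemma entry_1:
  assumes i: "i \<le> d"
  shows "real (valency p) * entry i 1 = \<theta> i * entry i 0"
proof -
  fix y :: 'v
  have "(A ** E i) $ y $ y = (\<Sum>z | adj y z. E i $ z $ y)"
    by (simp add: matrix_matrix_mult_def adjacency_matrix_def if_distrib[of "\<lambda>t. t * _"] sum.If_cases cong: if_cong)
  also have "\<dots> = (\<Sum>z | adj y z. of_real (entry i 1))"
    by (intro sum.cong) (auto simp: E_entry[OF i] gdist_commute[of _ y] gdist_eq_Suc_0_iff[THEN iffD2])
  also have "\<dots> = of_real (valency p * entry i 1)" by (simp add: card_neighbours)
  finally have "of_real (valency p * entry i 1) = (of_real (\<theta> i * entry i 0) :: complex)"
    by (simp add: A_E[OF i] mscale_def E_entry[OF i])
  then show ?thesis by (simp only: of_real_eq_iff)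
qed

text \<open>A real function on the vertices, regarded as a complex vector.\<close>

definition rvec :: "('v \<Rightarrow> real) \<Rightarrow> complex ^ 'v" where
  "rvec F = (\<chi> y. of_real (F y))"

lemma A_rvec: "(A *v rvec F) $ y = of_real (\<Sum>z | adj y z. F z)"
  by (simp add: A_vec rvec_def)

lemma Re_cinner_rvec: "Re (cinner (rvec F) (rvec F)) = (\<Sum>y\<in>UNIV. (F y)\<^sup>2)"
  by (simp add: cinner_self rvec_def)

lemma Re_cinner_A_rvec:
  "Re (cinner (A *v rvec F) (rvec F)) = (\<Sum>y\<in>UNIV. \<Sum>z | adj y z. F y * F z)"
proof -
  have "cinner (A *v rvec F) (rvec F) = of_real (\<Sum>y\<in>UNIV. \<Sum>z | adj y z. F y * F z)"
    unfolding cinner_def A_rvec by (simp add: rvec_def sum_distrib_left mult.commute)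
  then show ?thesis by simp
qed

text \<open>The entries of the idempotent of the least eigenvalue alternate in sign. A column \<open>f\<close> of this
  idempotent minimises the Rayleigh quotient. Let \<open>g\<close> have the same absolute values but alternating
  signs. The quotient does not increase when passing to \<open>g\<close>, so \<open>g\<close> is an eigenvector as well, and
  each edge contributes equally for \<open>f\<close> and \<open>g\<close>. The eigenvector equation of \<open>g\<close> excludes a zero
  entry, because all neighbours of a zero contribute with the same sign.\<close>

lemma entry_least_alternating:
  assumes "i < d"
  shows "entry d i * entry d (Suc i) < 0"
proof -
  fix x :: 'v
  define s where "s = entry d"
  define f where "f y = s (\<partial> x y)" for y
  define g where "g y = (-1) ^ \<partial> x y * \<bar>s (\<partial> x y)\<bar>" for y
  have Af: "A *v rvec f = of_real (\<theta> d) *s rvec f"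
  proof -
    have col: "rvec f $ y = E d $ y $ x" for y
      by (simp add: rvec_def f_def s_def E_entry gdist_commute)
    have "(A *v rvec f) $ y = (A ** E d) $ y $ x" for y
      by (simp add: matrix_vector_mult_def matrix_matrix_mult_def col)
    then show ?thesis by (simp add: vec_eq_iff col A_E mscale_def)
  qed
  have sq: "(f y)\<^sup>2 = (g y)\<^sup>2" for y
    by (simp add: f_def g_def power_mult_distrib power_even_eq[symmetric] flip: power_mult)
  have "Re (cinner (A *v rvec f) (rvec f)) = \<theta> d * Re (cinner (rvec f) (rvec f))"
    by (simp add: Af cinner_scale_left)
  then have Qf: "(\<Sum>y\<in>UNIV. \<Sum>z | adj y z. f y * f z) = \<theta> d * (\<Sum>y\<in>UNIV. (g y)\<^sup>2)"
    by (simp add: Re_cinner_A_rvec Re_cinner_rvec sq)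
  have same: "g y * g z = f y * f z" if "\<partial> x y = \<partial> x z" for y z
    using sq[of z] that by (simp add: f_def g_def power2_eq_square)
  have opposite: "g y * g z = - \<bar>f y * f z\<bar>" if "adj y z" "\<partial> x y \<noteq> \<partial> x z" for y z
  proof -
    have "\<partial> x y = Suc (\<partial> x z) \<or> \<partial> x z = Suc (\<partial> x y)"
      using gdist_adj(1,2)[OF that(1), of x] that(2) by linarith
    then show ?thesis
      by (auto simp: f_def g_def abs_mult simp flip: power_add mult_2)
  qed
  have le: "g y * g z \<le> f y * f z" if "adj y z" for y z
    using same[of y z] opposite[OF that] by (cases "\<partial> x y = \<partial> x z") auto
  have Qg: "(\<Sum>y\<in>UNIV. \<Sum>z | adj y z. g y * g z) = (\<Sum>y\<in>UNIV. \<Sum>z | adj y z. f y * f z)"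
  proof (rule antisym)
    show "(\<Sum>y\<in>UNIV. \<Sum>z | adj y z. g y * g z) \<le> (\<Sum>y\<in>UNIV. \<Sum>z | adj y z. f y * f z)"
      by (intro sum_mono le) simp
    show "(\<Sum>y\<in>UNIV. \<Sum>z | adj y z. f y * f z) \<le> (\<Sum>y\<in>UNIV. \<Sum>z | adj y z. g y * g z)"
      using least_eigenvalue_le[of "rvec g"] by (simp add: Qf Re_cinner_A_rvec Re_cinner_rvec)
  qed
  have edge: "f y * f z = g y * g z" if "adj y z" for y z
  proof -
    have "(\<Sum>y\<in>UNIV. \<Sum>z | adj y z. f y * f z - g y * g z) = 0"
      by (simp add: sum_subtractf Qg)
    then have "(\<Sum>z | adj y z. f y * f z - g y * g z) = 0"
      by (subst (asm) sum_nonneg_eq_0_iff) (auto intro!: sum_nonneg le)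
    then have "f y * f z - g y * g z = 0"
      using that by (subst (asm) sum_nonneg_eq_0_iff) (auto intro!: le)
    then show ?thesis by simp
  qed
  have "A *v rvec g = of_real (\<theta> d) *s rvec g"
    using Qg by (intro least_eigenvalue_eq) (simp add: Qf Re_cinner_A_rvec Re_cinner_rvec)
  then have Ag: "(\<Sum>z | adj y z. g z) = \<theta> d * g y" for y
  proof -
    assume "A *v rvec g = of_real (\<theta> d) *s rvec g"
    then have "(A *v rvec g) $ y = (of_real (\<theta> d) *s rvec g) $ y" by simp
    then have "(of_real (\<Sum>z | adj y z. g z) :: complex) = of_real (\<theta> d * g y)"
      unfolding A_rvec by (simp add: rvec_def)
    then show ?thesis by (simp only: of_real_eq_iff)
  qed
  have nonzero: "s j \<noteq> 0" if "j \<le> d" for j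
    using that
  proof (induction j)
    case 0 then show ?case using entry_0_pos[of d] by (simp add: s_def)
  next
    case (Suc j)
    show ?case
    proof
      assume z: "s (Suc j) = 0"
      obtain y where y: "\<partial> x y = Suc j" using exists_at_distance Suc.prems by blast
      have "(\<Sum>w | adj y w. (-1) ^ j * g w) = (-1) ^ j * (\<theta> d * g y)"
        by (simp add: Ag flip: sum_distrib_left)
      also have "\<dots> = 0" by (simp add: g_def y z)
      finally have sum0: "(\<Sum>w | adj y w. (-1) ^ j * g w) = 0" .
      have nonneg: "(-1) ^ j * g w \<ge> 0" if "adj y w" for w
      proof -
        have "\<partial> x w = j \<or> \<partial> x w = Suc j \<or> \<partial> x w = Suc (Suc j)"
          using gdist_adj(1,2)[OF that, of x] y by linarith
        then show ?thesis by (auto simp: g_def z simp flip: mult.assoc power_add mult_2)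
      qed
      obtain w where w: "adj y w" "\<partial> w x = j"
        using gdist_Suc_neighbour[of y x j] y by (auto simp: gdist_commute)
      have "(-1) ^ j * g w = 0"
        using sum0 nonneg w by (subst (asm) sum_nonneg_eq_0_iff) auto
      then show False using Suc w by (simp add: g_def gdist_commute)
    qed
  qed
  obtain y where y: "\<partial> x y = Suc i" using exists_at_distance[of "Suc i"] assms by auto
  obtain z where z: "adj y z" "\<partial> z x = i"
    using gdist_Suc_neighbour[of y x i] y by (auto simp: gdist_commute)
  have "f y * f z = - \<bar>f y * f z\<bar>"
    using edge[OF z(1)] opposite[OF z(1)] z y by (simp add: gdist_commute)
  moreover have prod: "f y * f z \<noteq> 0" "f y * f z = s i * s (Suc i)"
    using nonzero[of i] nonzero[of "Suc i"] assms y z by (simp_all add: f_def gdist_commute)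
  ultimately have "f y * f z < 0" by linarith
  then show ?thesis using prod by (simp add: s_def)
qed

end

section \<open>Delsarte cliques\<close>

text \<open>A Delsarte clique \<open>C\<close> with a base vertex \<open>x\<close> in it, in a graph of diameter at least 3.\<close>

locale delsarte_drg = drg_spectrum adj d p E \<theta>
  for adj :: "'v::finite \<Rightarrow> 'v \<Rightarrow> bool" and d p E \<theta> +
  fixes C :: "'v set" and x :: 'v
  assumes d_ge: "d \<ge> 3"
    and delsarte: "delsarte_clique adj p (\<theta> d) C"
    and x_in_C: "x \<in> C"
begin

abbreviation clique_dist :: "'v \<Rightarrow> nat" (\<open>\<delta>\<close>) where
  "\<delta> y \<equiv> set_dist adj y C"

lemma clique_adj: "y \<in> C \<Longrightarrow> z \<in> C \<Longrightarrow> y \<noteq> z \<Longrightarrow> adj y z"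
  using delsarte by (auto simp: delsarte_clique_def)

lemma valency_pos: "valency p > 0"
proof -
  obtain y where y: "\<partial> x y = 1" using exists_at_distance[of 1] d_ge by auto
  then have "y \<in> {z. adj x z}" by simp
  then have "card {z. adj x z} \<noteq> 0" by (metis card_eq_0_iff empty_iff finite)
  then show ?thesis by (simp add: card_neighbours)
qed

lemma least_eigenvalue_neg: "\<theta> d < 0"
proof -
  have "entry d 1 < 0"
    using entry_least_alternating[of 0] entry_0_pos[of d] d_ge by (simp add: mult_less_0_iff)
  then have "\<theta> d * entry d 0 < 0"
    using entry_1[of d] valency_pos by (simp flip: entry_1[of d] add: mult_less_0_iff)
  then show ?thesis using entry_0_pos[of d] by (simp add: mult_less_0_iff)
qed

lemma E_0: "E 0 $ y $ z = 1 / of_nat CARD('v)"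
  using ordering by (simp add: primitive_idempotent_ordering_def)

lemma eigenvalue_0: "\<theta> 0 = real (valency p)"
proof -
  obtain y where y: "adj x y" using exists_at_distance[of 1 x] d_ge by auto
  have "complex_of_real (entry 0 1) = of_real (entry 0 0)"
    using E_entry[of 0 x y] E_entry[of 0 x x] y by (simp add: E_0)
  then have "entry 0 1 = entry 0 0" by (simp only: of_real_eq_iff)
  then show ?thesis using entry_1[of 0] entry_0_pos[of 0] by simp
qed

lemma card_clique_minus_1: "real (card C) - 1 = - real (valency p) / \<theta> d"
  using delsarte by (simp add: delsarte_clique_def)

lemma matrix_char_vec: "(B *v char_vec Y) $ y = (\<Sum>z\<in>Y. B $ y $ z)"
  by (simp add: matrix_vector_mult_def char_vec_def if_distrib[of "\<lambda>t. _ * t"] sum.If_cases cong: if_cong)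

lemma E_clique:
  assumes i: "i \<le> d" and y: "y \<in> C"
  shows "(E i *v char_vec C) $ y = of_real (entry i 0 * (1 - \<theta> i / \<theta> d))"
proof -
  have "(E i *v char_vec C) $ y = (\<Sum>z\<in>C. of_real (entry i (\<partial> y z)))"
    by (simp add: matrix_char_vec E_entry[OF i])
  also have "\<dots> = of_real (entry i 0) + (\<Sum>z\<in>C - {y}. of_real (entry i (\<partial> y z)))"
    using y by (subst sum.remove[of _ y]) auto
  also have "(\<Sum>z\<in>C - {y}. of_real (entry i (\<partial> y z))) = (\<Sum>z\<in>C - {y}. of_real (entry i 1) :: complex)"
    using clique_adj[OF y] by (intro sum.cong) auto
  also have "\<dots> = of_real ((real (card C) - 1) * entry i 1)"
  proof -
    have "card C = Suc (card (C - {y}))" using y by (intro card.remove) auto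
    then show ?thesis by simp
  qed
  also have "(real (card C) - 1) * entry i 1 = - (\<theta> i / \<theta> d) * entry i 0"
    unfolding card_clique_minus_1 using entry_1[OF i] by simp
  finally show ?thesis by (simp add: algebra_simps)
qed

text \<open>Delsarte's bound is attained, so the characteristic vector of the clique has no component in the
  eigenspace of the least eigenvalue.\<close>

lemma E_least_clique: "E d *v char_vec C = 0"
proof -
  have "cinner (E d *v char_vec C) (E d *v char_vec C) = cinner (E d *v char_vec C) (char_vec C)"
    by (simp add: cinner_E_self)
  also have "\<dots> = 0"
    unfolding cinner_def using E_clique[of d] least_eigenvalue_neg
    by (intro sum.neutral) (simp add: char_vec_def)
  finally show ?thesis by simp
qed

lemma clique_dist_attained: obtains z where "z \<in> C" "\<partial> y z = \<delta> y"
proof -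
  have "\<delta> y \<in> gdist adj y ` C"
    unfolding set_dist_def using x_in_C by (intro Min_in) auto
  then show ?thesis using that by auto
qed

lemma clique_dist_bounds:
  assumes "z \<in> C"
  shows "\<partial> y z = \<delta> y \<or> \<partial> y z = Suc (\<delta> y)"
proof -
  have le: "\<delta> y \<le> \<partial> y z" unfolding set_dist_def using assms by (intro Min_le) auto
  obtain w where w: "w \<in> C" "\<partial> y w = \<delta> y" by (rule clique_dist_attained)
  have "\<partial> y z \<le> Suc (\<delta> y)"
    using clique_adj[OF w(1) assms] gdist_adj(2)[of w z y] w by (cases "w = z") auto
  with le show ?thesis by linarith
qed

lemma clique_entry_sum: "(\<Sum>z\<in>C. entry d (\<partial> y z)) = 0"
proof -
  have "(E d *v char_vec C) $ y = of_real (\<Sum>z\<in>C. entry d (\<partial> y z))"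
    by (simp add: matrix_char_vec E_entry)
  then have "of_real (\<Sum>z\<in>C. entry d (\<partial> y z)) = (0 :: complex)"
    unfolding E_least_clique by simp
  then show ?thesis by (simp only: of_real_eq_0_iff)
qed

lemma clique_dist_less_diam: "\<delta> y < d"
proof (rule ccontr)
  assume "\<not> ?thesis"
  then have "\<partial> y z = d" if "z \<in> C" for z
    using clique_dist_bounds[OF that, of y] gdist_le_diam[of y z] by auto
  then have "real (card C) * entry d d = 0" using clique_entry_sum[of y] by simp
  moreover have "entry d d \<noteq> 0" using entry_least_alternating[of "d - 1"] d_ge by auto
  ultimately show False using x_in_C by auto
qed

text \<open>The number of vertices of the clique that are nearest to a given vertex at distance \<open>i\<close> from the
  clique. All others are at distance \<open>i + 1\<close>, so the number is determined by \<open>clique_entry_sum\<close>. The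
  denominator is nonzero for \<open>i < d\<close> as the two entries have opposite signs.\<close>

definition nearest_count :: "nat \<Rightarrow> real" where
  "nearest_count i = real (card C) * entry d (Suc i) / (entry d (Suc i) - entry d i)"

lemma card_nearest:
  "real (card {z\<in>C. \<partial> y z = \<delta> y}) = nearest_count (\<delta> y)"
  "real (card {z\<in>C. \<partial> y z = Suc (\<delta> y)}) = real (card C) - nearest_count (\<delta> y)"
proof -
  let ?m = "\<delta> y" and ?N = "{z\<in>C. \<partial> y z = \<delta> y}" and ?F = "{z\<in>C. \<partial> y z = Suc (\<delta> y)}"
  have C: "C = ?N \<union> ?F" using clique_dist_bounds by blast
  have "card C = card ?N + card ?F" by (subst (1) C, rule card_Un_disjoint) auto
  then have far: "real (card ?F) = real (card C) - real (card ?N)" by simp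
  have "(\<Sum>z\<in>C. entry d (\<partial> y z)) = (\<Sum>z\<in>?N. entry d (\<partial> y z)) + (\<Sum>z\<in>?F. entry d (\<partial> y z))"
    by (subst (1) C, rule sum.union_disjoint) auto
  also have "\<dots> = real (card ?N) * entry d ?m + real (card ?F) * entry d (Suc ?m)" by simp
  finally have "real (card ?N) * entry d ?m + real (card ?F) * entry d (Suc ?m) = 0"
    by (simp add: clique_entry_sum)
  then have eq: "real (card ?N) * (entry d (Suc ?m) - entry d ?m) = real (card C) * entry d (Suc ?m)"
    unfolding far by (simp add: algebra_simps)
  have "entry d (Suc ?m) - entry d ?m \<noteq> 0"
    using entry_least_alternating[OF clique_dist_less_diam[of y]] not_square_less_zero[of "entry d ?m"] by auto
  then show near: "real (card ?N) = nearest_count ?m"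
    using eq by (simp add: nearest_count_def field_simps)
  show "real (card ?F) = real (card C) - nearest_count ?m" by (simp add: far near)
qed

lemma nearest_count_pos: "nearest_count (\<delta> y) > 0"
proof -
  obtain z where "z \<in> C" "\<partial> y z = \<delta> y" by (rule clique_dist_attained)
  then have "{z\<in>C. \<partial> y z = \<delta> y} \<noteq> {}" by blast
  then show ?thesis by (simp add: card_gt_0_iff flip: card_nearest(1))
qed

text \<open>The clique is completely regular: a distance-dependent matrix maps its characteristic vector
  to a vector that depends only on the distance to the clique.\<close>

lemma radial_char_clique:
  assumes B: "\<And>y z. B $ y $ z = f (\<partial> y z)"
  shows "(B *v char_vec C) $ y = of_real (nearest_count (\<delta> y)) * f (\<delta> y)
    + of_real (real (card C) - nearest_count (\<delta> y)) * f (Suc (\<delta> y))"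
proof -
  let ?N = "{z\<in>C. \<partial> y z = \<delta> y}" and ?F = "{z\<in>C. \<partial> y z = Suc (\<delta> y)}"
  have C: "C = ?N \<union> ?F" using clique_dist_bounds by blast
  have "(B *v char_vec C) $ y = (\<Sum>z\<in>C. f (\<partial> y z))" by (simp add: matrix_char_vec B)
  also have "\<dots> = (\<Sum>z\<in>?N. f (\<partial> y z)) + (\<Sum>z\<in>?F. f (\<partial> y z))"
    by (subst (1) C, rule sum.union_disjoint) auto
  also have "\<dots> = of_real (real (card ?N)) * f (\<delta> y) + of_real (real (card ?F)) * f (Suc (\<delta> y))"
    by simp
  finally show ?thesis unfolding card_nearest .
qed

end

section \<open>The module spanned by the cells\<close>

context delsarte_drg
begin

abbreviation W :: "(complex ^ 'v) set" where
  "W \<equiv> clique_module adj d C x"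

abbreviation P :: "(complex ^ 'v) set" where
  "P \<equiv> primary_module adj x"

abbreviation U :: "(complex ^ 'v) set" where
  "U \<equiv> orth_complement_in W P"

lemma clique_dist_base: "\<partial> x y = \<delta> y \<or> \<partial> x y = Suc (\<delta> y)"
  using clique_dist_bounds[OF x_in_C, of y] by (simp add: gdist_commute)

lemma cell_minus_iff: "y \<in> cell_minus adj C x i \<longleftrightarrow> \<delta> y = i \<and> \<partial> x y = i"
  by (simp add: cell_minus_def cell_def gsphere_def)

lemma cell_plus_iff: "y \<in> cell_plus adj C x i \<longleftrightarrow> \<delta> y = i \<and> \<partial> x y = Suc i"
  by (simp add: cell_plus_def cell_def gsphere_def)

lemma clique_dist_0_iff: "\<delta> y = 0 \<longleftrightarrow> y \<in> C"
proof
  assume "\<delta> y = 0"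
  then show "y \<in> C" using clique_dist_attained[of y] by (metis gdist_eq_0_iff)
next
  assume "y \<in> C"
  then show "\<delta> y = 0" using clique_dist_bounds[of y y] by simp
qed

text \<open>The span of the cells consists of the vectors that depend only on the distances to \<open>x\<close> and
  to \<open>C\<close>.\<close>

lemma clique_module_iff:
  "w \<in> W \<longleftrightarrow> (\<exists>f. \<forall>y. w $ y = f (\<partial> x y) (\<delta> y))"
proof
  define S :: "(complex ^ 'v) set" where "S = {w. \<exists>f. \<forall>y. w $ y = f (\<partial> x y) (\<delta> y)}"
  have S: "w \<in> S" if "\<And>y. w $ y = f (\<partial> x y) (\<delta> y)" for w f
    using that unfolding S_def by blast
  have "W \<subseteq> S"
    unfolding clique_module_def
  proof (rule vec.span_minimal)
    show "vec.subspace S"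
    proof (rule vec.subspaceI)
      show "0 \<in> S" by (rule S[of _ "\<lambda>m i. 0"]) simp
    next
      fix u v assume "u \<in> S" "v \<in> S"
      then obtain f g where "\<And>y. u $ y = f (\<partial> x y) (\<delta> y)" "\<And>y. v $ y = g (\<partial> x y) (\<delta> y)"
        unfolding S_def by blast
      then show "u + v \<in> S" by (intro S[of _ "\<lambda>m i. f m i + g m i"]) simp
    next
      fix c u assume "u \<in> S"
      then obtain f where "\<And>y. u $ y = f (\<partial> x y) (\<delta> y)" unfolding S_def by blast
      then show "c *s u \<in> S" by (intro S[of _ "\<lambda>m i. c * f m i"]) simp
    qed
    have "char_vec (cell_minus adj C x i) \<in> S" for i
      by (rule S[of _ "\<lambda>m j. if j = i \<and> m = i then 1 else 0"]) (simp add: char_vec_nth cell_minus_iff)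
    moreover have "char_vec (cell_plus adj C x i) \<in> S" for i
      by (rule S[of _ "\<lambda>m j. if j = i \<and> m = Suc i then 1 else 0"]) (simp add: char_vec_nth cell_plus_iff)
    ultimately show "{char_vec (cell_minus adj C x i) |i. i \<le> d - 1} \<union>
      {char_vec (cell_plus adj C x i) |i. i \<le> d - 1} \<subseteq> S"
      by blast
  qed
  then show "\<exists>f. \<forall>y. w $ y = f (\<partial> x y) (\<delta> y)" if "w \<in> W"
    using that unfolding S_def by blast
next
  assume "\<exists>f. \<forall>y. w $ y = f (\<partial> x y) (\<delta> y)"
  then obtain f where f: "\<And>y. w $ y = f (\<partial> x y) (\<delta> y)" by auto
  have "w = (\<Sum>i\<le>d - 1. f i i *s char_vec (cell_minus adj C x i) + f (Suc i) i *s char_vec (cell_plus adj C x i))"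
    unfolding vec_eq_iff
  proof
    fix y
    have le: "\<delta> y \<le> d - 1" using clique_dist_less_diam[of y] by linarith
    have "(\<Sum>i\<le>d - 1. f i i *s char_vec (cell_minus adj C x i) + f (Suc i) i *s char_vec (cell_plus adj C x i)) $ y
       = (\<Sum>i\<le>d - 1. if i = \<delta> y then w $ y else 0)"
      using clique_dist_base[of y] unfolding sum_component
      by (intro sum.cong) (auto simp: f char_vec_nth cell_minus_def cell_plus_def cell_def gsphere_def)
    also have "\<dots> = w $ y" using le by simp
    finally show "w $ y = (\<Sum>i\<le>d - 1. f i i *s char_vec (cell_minus adj C x i)
      + f (Suc i) i *s char_vec (cell_plus adj C x i)) $ y" by simp
  qed
  also have "\<dots> \<in> W"
    unfolding clique_module_def
    by (intro vec.span_sum vec.span_add vec.span_scale vec.span_base) auto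
  finally show "w \<in> W" .
qed

lemma matrix_axis: "(B *v axis x 1) $ y = (B $ y $ x :: complex)"
  by (simp add: matrix_vector_mult_def axis_nth_if if_distrib[of "\<lambda>t. _ * t"] cong: if_cong)

lemma primary_module_iff: "u \<in> P \<longleftrightarrow> (\<exists>f. \<forall>y. u $ y = f (\<partial> x y))"
proof
  assume "u \<in> P"
  then obtain B where B: "radial B" "u = B *v axis x 1"
    by (auto simp: primary_module_def bose_mesner_iff_radial)
  then obtain f where "\<And>y z. B $ y $ z = f (\<partial> y z)" by (metis radialE)
  then show "\<exists>f. \<forall>y. u $ y = f (\<partial> x y)" by (auto simp: B(2) matrix_axis gdist_commute)
next
  assume "\<exists>f. \<forall>y. u $ y = f (\<partial> x y)"
  then obtain f where f: "\<And>y. u $ y = f (\<partial> x y)" by auto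
  define B :: "complex ^ 'v ^ 'v" where "B = (\<chi> y z. f (\<partial> y z))"
  have "radial B" by (rule radialI[of _ f]) (simp add: B_def)
  moreover have "u = B *v axis x 1"
    by (simp add: vec_eq_iff matrix_axis B_def f gdist_commute)
  ultimately show "u \<in> P" by (auto simp: primary_module_def bose_mesner_iff_radial)
qed

lemma primary_moduleI: "(\<And>y. u $ y = f (\<partial> x y)) \<Longrightarrow> u \<in> P"
  using primary_module_iff by auto

lemma radial_axis_in_primary: "radial B \<Longrightarrow> B *v axis x 1 \<in> P"
  by (auto simp: primary_module_def bose_mesner_iff_radial)

lemma primary_subset: "P \<subseteq> W"
proof
  fix u assume "u \<in> P"
  then obtain f where "\<And>y. u $ y = f (\<partial> x y)" by (auto simp: primary_module_iff)
  then show "u \<in> W" unfolding clique_module_iff by (intro exI[of _ "\<lambda>m i. f m"]) simp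
qed

lemma subspace_W: "vec.subspace W"
  by (simp add: clique_module_def)

lemma radial_clique_in_W:
  assumes "radial B"
  shows "B *v char_vec C \<in> W"
proof -
  obtain f where "\<And>y z. B $ y $ z = f (\<partial> y z)" using assms by (metis radialE)
  then show ?thesis
    unfolding clique_module_iff
    by (intro exI[of _ "\<lambda>m i. of_real (nearest_count i) * f i
      + of_real (real (card C) - nearest_count i) * f (Suc i)"] allI radial_char_clique)
qed

text \<open>The span of the cells is the sum of the cyclic modules of the Bose-Mesner algebra generated
  by the base vertex and by the clique. This makes it invariant under the adjacency matrix, without
  a proof that the partition into cells is equitable. The cells $C_i$ lie in the second module by
  induction on $i$, since the image of the clique under $A_i$ involves only $C_i$ and
  $C_{i-1}$, with a nonzero coefficient at $C_i$. Then $C_i^-$ and $C_i^+$ are reached alternately,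
  since $C_i^-\cup C_i^+=C_i$ and $C_{i+1}^-\cup C_i^+$ is the sphere of radius $i+1$.\<close>

lemma clique_module_decomposition:
  assumes "w \<in> W"
  obtains B D where "radial B" "radial D" "w = B *v axis x 1 + D *v char_vec C"
proof -
  define S where "S = {B *v axis x 1 + D *v char_vec C | B D. radial B \<and> radial D}"
  have S: "vec.subspace S"
  proof (rule vec.subspaceI)
    have "0 = mat 0 *v axis x 1 + mat 0 *v char_vec C" by (simp add: mat_vec)
    then show "0 \<in> S" unfolding S_def using radial_mat by blast
  next
    fix u v assume "u \<in> S" "v \<in> S"
    then obtain B D B' D' where "radial B" "radial D" "radial B'" "radial D'"
      "u = B *v axis x 1 + D *v char_vec C" "v = B' *v axis x 1 + D' *v char_vec C"
      unfolding S_def by blast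
    then have "u + v = (B + B') *v axis x 1 + (D + D') *v char_vec C"
      "radial (B + B')" "radial (D + D')"
      by (simp_all add: matrix_vector_mult_add_rdistrib radial_add)
    then show "u + v \<in> S" unfolding S_def by blast
  next
    fix c u assume "u \<in> S"
    then obtain B D where "radial B" "radial D" "u = B *v axis x 1 + D *v char_vec C"
      unfolding S_def by blast
    then have "c *s u = mscale c B *v axis x 1 + mscale c D *v char_vec C"
      "radial (mscale c B)" "radial (mscale c D)"
      by (simp_all add: mscale_vec vec.scale_right_distrib radial_mscale)
    then show "c *s u \<in> S" unfolding S_def by blast
  qed
  have clique: "D *v char_vec C \<in> S" if "radial D" for D
  proof -
    have "D *v char_vec C = mat 0 *v axis x 1 + D *v char_vec C" by (simp add: mat_vec)
    then show ?thesis unfolding S_def using radial_mat that by blast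
  qed
  have base: "B *v axis x 1 \<in> S" if "radial B" for B
  proof -
    have "B *v axis x 1 = B *v axis x 1 + mat 0 *v char_vec C" by (simp add: mat_vec)
    then show ?thesis unfolding S_def using radial_mat that by blast
  qed
  have dm: "(distance_matrix i *v char_vec C) $ y = of_real (nearest_count (\<delta> y)) * (if \<delta> y = i then 1 else 0)
    + of_real (real (card C) - nearest_count (\<delta> y)) * (if Suc (\<delta> y) = i then 1 else 0)" for i y
    by (rule radial_char_clique) (simp add: distance_matrix_def)
  have cell: "char_vec (cell adj C i) \<in> S" for i
  proof (induction i)
    case 0
    have "char_vec (cell adj C 0) = char_vec C"
      by (simp add: char_vec_nth cell_def clique_dist_0_iff)
    then show ?case using clique[OF radial_mat[of 1]] by (simp add: mat_vec)
  next
    case (Suc i)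
    show ?case
    proof (cases "cell adj C (Suc i) = {}")
      case True
      then have "char_vec (cell adj C (Suc i)) = (0 :: complex ^ 'v)" by (simp add: char_vec_nth vec_eq_iff)
      then show ?thesis using S by (simp add: vec.subspace_0)
    next
      case False
      let ?n = nearest_count
      obtain y where "\<delta> y = Suc i" using False by (auto simp: cell_def)
      then have n: "?n (Suc i) \<noteq> 0" using nearest_count_pos[of y] by simp
      have "char_vec (cell adj C (Suc i)) = of_real (1 / ?n (Suc i)) *s
        (distance_matrix (Suc i) *v char_vec C
          - of_real (real (card C) - ?n i) *s char_vec (cell adj C i))"
        using n by (simp add: vec_eq_iff dm char_vec_nth cell_def diff_divide_distrib)
      also have "\<dots> \<in> S"
        by (intro vec.subspace_scale[OF S] vec.subspace_diff[OF S] clique radial_distance_matrix Suc.IH)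
      finally show ?thesis .
    qed
  qed
  have plus: "char_vec (cell_plus adj C x i) = char_vec (cell adj C i) - char_vec (cell_minus adj C x i)" for i
    unfolding vec_eq_iff
  proof
    fix y
    show "char_vec (cell_plus adj C x i) $ y
      = (char_vec (cell adj C i) - char_vec (cell_minus adj C x i)) $ y"
      using clique_dist_base[of y]
      by (auto simp: char_vec_nth cell_def cell_minus_iff cell_plus_iff)
  qed
  have minus: "char_vec (cell_minus adj C x i) \<in> S" for i
  proof (induction i)
    case 0
    have "char_vec (cell_minus adj C x 0) = distance_matrix 0 *v axis x 1"
      using x_in_C by (auto simp: vec_eq_iff matrix_axis distance_matrix_def char_vec_nth cell_minus_def
        cell_def gsphere_def clique_dist_0_iff)
    then show ?case using base radial_distance_matrix by metis
  next
    case (Suc i)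
    have "char_vec (cell_minus adj C x (Suc i)) =
      distance_matrix (Suc i) *v axis x 1 - char_vec (cell_plus adj C x i)"
      unfolding vec_eq_iff
    proof
      fix y
      show "char_vec (cell_minus adj C x (Suc i)) $ y =
        (distance_matrix (Suc i) *v axis x 1 - char_vec (cell_plus adj C x i)) $ y"
        using clique_dist_base[of y]
        by (auto simp: matrix_axis distance_matrix_def char_vec_nth cell_minus_iff cell_plus_iff
          gdist_commute[of _ x])
    qed
    also have "\<dots> \<in> S" unfolding plus
      by (intro vec.subspace_diff[OF S] base radial_distance_matrix cell Suc.IH)
    finally show ?case .
  qed
  have "char_vec (cell_plus adj C x i) \<in> S" for i
    unfolding plus by (intro vec.subspace_diff[OF S] cell minus)
  then have "W \<subseteq> S"
    unfolding clique_module_def using minus by (intro vec.span_minimal S) blast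
  then show ?thesis using assms that unfolding S_def by blast
qed

lemma radial_W:
  assumes "radial R" "w \<in> W"
  shows "R *v w \<in> W"
proof -
  obtain B D where B: "radial B" "radial D" "w = B *v axis x 1 + D *v char_vec C"
    using clique_module_decomposition[OF assms(2)] .
  then have "R *v w = (R ** B) *v axis x 1 + (R ** D) *v char_vec C"
    by (simp add: matrix_vector_right_distrib matrix_vector_mul_assoc)
  moreover have "(R ** B) *v axis x 1 \<in> W"
    using primary_subset radial_axis_in_primary[OF radial_mult[OF assms(1) B(1)]] by blast
  ultimately show ?thesis
    using vec.subspace_add[OF subspace_W] radial_clique_in_W[OF radial_mult[OF assms(1) B(2)]] by simp
qed

section \<open>The orthogonal complement of the primary module\<close>

lemma subspace_U: "vec.subspace U"
  using subspace_W unfolding orth_complement_in_def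
  by (auto simp: vec.subspace_def cinner_add_left cinner_scale_left)

lemma radial_primary:
  assumes "radial B" "u \<in> P"
  shows "B *v u \<in> P"
  using assms radial_mult
  by (auto simp: primary_module_def bose_mesner_iff_radial matrix_vector_mul_assoc)

lemma radial_U: "radial B \<Longrightarrow> w \<in> U \<Longrightarrow> B *v w \<in> U"
  by (auto simp: orth_complement_in_def cinner_radial radial_W radial_primary radial_mat_cnj)

text \<open>Entrywise multiplication by a function of the distance from the base vertex covers both the
  dual adjacency matrix and the dual idempotents.\<close>

lemma diagonal_U:
  assumes "w \<in> U"
  shows "(\<chi> y. g (\<partial> x y) * w $ y) \<in> U"
proof -
  obtain f where f: "\<And>y. w $ y = f (\<partial> x y) (\<delta> y)"
    using assms by (auto simp: orth_complement_in_def clique_module_iff)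
  have "(\<chi> y. g (\<partial> x y) * w $ y) \<in> W"
    unfolding clique_module_iff by (rule exI[of _ "\<lambda>m i. g m * f m i"]) (simp add: f)
  moreover have "cinner (\<chi> y. g (\<partial> x y) * w $ y) u = 0" if "u \<in> P" for u
  proof -
    obtain k where k: "\<And>y. u $ y = k (\<partial> x y)" using \<open>u \<in> P\<close> by (auto simp: primary_module_iff)
    have "(\<chi> y. cnj (g (\<partial> x y)) * u $ y) \<in> P"
      by (rule primary_moduleI[of _ "\<lambda>m. cnj (g m) * k m"]) (simp add: k)
    then have "cinner w (\<chi> y. cnj (g (\<partial> x y)) * u $ y) = 0"
      using assms by (simp add: orth_complement_in_def)
    then show ?thesis by (simp add: cinner_def ac_simps)
  qed
  ultimately show ?thesis by (simp add: orth_complement_in_def)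
qed

lemma dual_idempotent_vec: "(dual_idempotent adj x i *v w) $ y = (if \<partial> x y = i then 1 else 0) * w $ y"
proof -
  have "(dual_idempotent adj x i *v w) $ y = (\<Sum>z\<in>UNIV. if z = y then (if \<partial> x y = i then w $ y else 0) else 0)"
    unfolding matrix_vector_mult_def dual_idempotent_def vec_lambda_beta by (rule sum.cong) auto
  then show ?thesis by simp
qed

lemma dual_idempotent_U:
  assumes "w \<in> U"
  shows "dual_idempotent adj x i *v w \<in> U"
proof -
  have "dual_idempotent adj x i *v w = (\<chi> y. (\<lambda>m. if m = i then 1 else 0) (\<partial> x y) * w $ y)"
    by (simp add: vec_eq_iff dual_idempotent_vec)
  then show ?thesis using diagonal_U[OF assms, of "\<lambda>m. if m = i then 1 else 0"] by simp
qed

text \<open>The orthogonal projection to \<open>U\<close> of the characteristic vector of the clique. The clique meets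
  the spheres of radius 0 and 1 in 1 and \<open>card C - 1\<close> vertices, which gives the coefficients.\<close>

definition clique_part :: "complex ^ 'v" where
  "clique_part = char_vec C - (axis x 1 +
     of_real ((real (card C) - 1) / real (valency p)) *s (A *v axis x 1))"

lemma clique_part_nth:
  "clique_part $ y = (if \<partial> x y = 1
     then (if y \<in> C then 1 else 0) - of_real ((real (card C) - 1) / real (valency p)) else 0)"
proof (cases "y = x")
  case True
  moreover have "\<not> adj x x" using gdist_eq_Suc_0[of x x] by auto
  ultimately show ?thesis using x_in_C
    by (simp add: clique_part_def matrix_axis char_vec_nth axis_nth_if adjacency_matrix_def)
next
  case False
  moreover have "adj x y" if "y \<in> C" using clique_adj[OF x_in_C that] False by auto
  ultimately show ?thesis
    by (auto simp: clique_part_def matrix_axis char_vec_nth axis_nth_if adjacency_matrix_def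
      adj_sym[of y x])
qed

lemma clique_part_in_U: "clique_part \<in> U"
proof -
  have "clique_part \<in> W"
    unfolding clique_module_iff
    by (rule exI[of _ "\<lambda>m i. if m = 1 then (if i = 0 then 1 else 0)
      - of_real ((real (card C) - 1) / real (valency p)) else 0"])
      (simp only: clique_part_nth clique_dist_0_iff simp_thms)
  moreover have "cinner clique_part u = 0" if u: "u \<in> P" for u
  proof -
    obtain k where k: "\<And>y. u $ y = k (\<partial> x y)" using u by (auto simp: primary_module_iff)
    let ?a = "(real (card C) - 1) / real (valency p)"
    have "cinner clique_part u = (\<Sum>y | adj x y. ((if y \<in> C then 1 else 0) - of_real ?a) * cnj (k 1))"
      unfolding cinner_def
      by (rule sum.mono_neutral_cong_right) (auto simp: clique_part_nth k)
    also have "\<dots> = of_real (real (card ({y. adj x y} \<inter> C)) - real (valency p) * ?a) * cnj (k 1)"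
      by (simp add: sum_subtractf card_neighbours sum.If_cases flip: sum_distrib_right)
    also have "{y. adj x y} \<inter> C = C - {x}"
      using clique_adj[OF x_in_C] gdist_self[of x] by (auto dest: gdist_eq_Suc_0)
    also have "real (card (C - {x})) = real (card C) - 1"
      using card.remove[of C x] x_in_C by simp
    also have "real (card C) - 1 - real (valency p) * ?a = 0"
      using valency_pos by simp
    finally show ?thesis by simp
  qed
  ultimately show ?thesis by (simp add: orth_complement_in_def)
qed

text \<open>The complement is the cyclic module of the Bose-Mesner algebra generated by this projection: the
  component \<open>R *v axis x 1\<close> in the primary module lies in the complement as well and so vanishes.\<close>

lemma U_cyclic:
  assumes "w \<in> U"
  obtains D where "radial D" "w = D *v clique_part"
proof -
  have "w \<in> W" using assms by (simp add: orth_complement_in_def)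
  then obtain B D where BD: "radial B" "radial D" "w = B *v axis x 1 + D *v char_vec C"
    by (rule clique_module_decomposition)
  define R where "R = B + D ** (mat 1 + mscale (of_real ((real (card C) - 1) / real (valency p))) A)"
  have R: "radial R" unfolding R_def
    by (intro radial_add radial_mult BD radial_mat radial_mscale radial_A)
  have "w = R *v axis x 1 + D *v clique_part"
    by (simp add: BD(3) R_def clique_part_def matrix_vector_mult_add_rdistrib matrix_vector_mult_diff_distrib
      matrix_vector_right_distrib mscale_vec mat_vec flip: matrix_vector_mul_assoc)
  then have "R *v axis x 1 = w - D *v clique_part" by simp
  then have "R *v axis x 1 \<in> U"
    using vec.subspace_diff[OF subspace_U assms radial_U[OF BD(2) clique_part_in_U]] by simp
  then have "cinner (R *v axis x 1) (R *v axis x 1) = 0"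
    using radial_axis_in_primary[OF R] by (simp add: orth_complement_in_def)
  then have "w = D *v clique_part" using \<open>w = R *v axis x 1 + D *v clique_part\<close> by simp
  with BD(2) show ?thesis by (rule that)
qed

section \<open>Spheres and the dual endpoint\<close>

lemma cell_plus_nonempty:
  assumes "i < d"
  shows "cell_plus adj C x i \<noteq> {}"
proof -
  obtain y where y: "\<partial> x y = d" using exists_at_distance[of d] by auto
  have "\<delta> y = d - 1" using clique_dist_base[of y] clique_dist_less_diam[of y] y by auto
  then obtain z where z: "z \<in> C" "\<partial> y z = d - 1" using clique_dist_attained[of y] by metis
  have "i \<le> \<partial> y z" using z assms by simp
  then obtain w where w: "\<partial> w z = i" "\<partial> y w = d - 1 - i"
    unfolding z(2)[symmetric] by (rule gdist_geodesic)
  have "d \<le> \<partial> x w + (d - 1 - i)" using gdist_triangle[of x y w] y w by (simp add: gdist_commute)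
  then have "\<partial> x w \<ge> Suc i" using assms by linarith
  then have "\<delta> w = i" "\<partial> x w = Suc i"
    using clique_dist_bounds[OF z(1), of w] w clique_dist_base[of w] by auto
  then have "w \<in> cell_plus adj C x i" by (simp add: cell_plus_def cell_def gsphere_def)
  then show ?thesis by blast
qed

lemma cell_minus_nonempty:
  assumes "0 < i" "i < d"
  shows "cell_minus adj C x i \<noteq> {}"
proof -
  obtain w where w: "\<delta> w = i" "\<partial> x w = Suc i"
    using cell_plus_nonempty[OF assms(2)] by (auto simp: cell_plus_def cell_def gsphere_def)
  obtain z where z: "z \<in> C" "\<partial> w z = i" using clique_dist_attained[of w] w by metis
  \<comment> \<open>Since \<open>x\<close> and \<open>z\<close> are symmetric, there is also a vertex at distance \<open>i + 1\<close> from \<open>z\<close>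
    and \<open>i\<close> from \<open>x\<close>.\<close>
  have "w \<in> gsphere adj (Suc i) x \<inter> gsphere adj i z"
    using w z by (simp add: gsphere_def gdist_commute)
  then have "p (\<partial> x z) (Suc i) i \<noteq> 0"
    by (metis card_spheres card_eq_0_iff empty_iff finite)
  then have "card (gsphere adj (Suc i) z \<inter> gsphere adj i x) \<noteq> 0"
    by (simp add: card_spheres gdist_commute)
  then obtain y where y: "\<partial> z y = Suc i" "\<partial> x y = i" by (auto simp: gsphere_def dest!: card_ge_0_finite)
  have "\<delta> y = i"
    using clique_dist_bounds[OF z(1), of y] clique_dist_base[of y] y by (auto simp: gdist_commute)
  then have "y \<in> cell_minus adj C x i" using y by (simp add: cell_minus_def cell_def gsphere_def)
  then show ?thesis by blast
qed

text \<open>The two cells on the sphere of radius \<open>i\<close> span a plane, in which this vector spans the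
  orthogonal complement of the characteristic vector of the sphere. This is for
  \<open>0 < i < d\<close>; for \<open>i = d\<close> the vector is zero, and for \<open>i = 0\<close> only its zero multiple matters.\<close>

definition sphere_vec :: "nat \<Rightarrow> complex ^ 'v" where
  "sphere_vec i = of_nat (card (cell_plus adj C x (i - 1))) *s char_vec (cell_minus adj C x i)
     - of_nat (card (cell_minus adj C x i)) *s char_vec (cell_plus adj C x (i - 1))"

lemma cinner_on_sphere:
  assumes "i > 0" and v: "\<And>y. v $ y = (if \<partial> x y = i then if \<delta> y = i then a else b else 0)"
    and u: "\<And>y. u $ y = k (\<partial> x y)"
  shows "cinner v u = (of_nat (card (cell_minus adj C x i)) * a
    + of_nat (card (cell_plus adj C x (i - 1))) * b) * cnj (k i)"
proof -
  let ?M = "cell_minus adj C x i" and ?Q = "cell_plus adj C x (i - 1)"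
  have disj: "?M \<inter> ?Q = {}" using assms(1) by (auto simp: cell_minus_iff cell_plus_iff)
  have on: "y \<in> ?M \<longleftrightarrow> \<partial> x y = i \<and> \<delta> y = i" "y \<in> ?Q \<longleftrightarrow> \<partial> x y = i \<and> \<delta> y \<noteq> i" for y
    unfolding cell_minus_iff cell_plus_iff using assms(1) clique_dist_base[of y] by arith+
  have "cinner v u = (\<Sum>y\<in>?M \<union> ?Q. v $ y * cnj (u $ y))"
    unfolding cinner_def
  proof (rule sum.mono_neutral_right)
    show "\<forall>y\<in>UNIV - (?M \<union> ?Q). v $ y * cnj (u $ y) = 0"
    proof
      fix y assume "y \<in> UNIV - (?M \<union> ?Q)"
      then have "\<partial> x y \<noteq> i" using on by blast
      then show "v $ y * cnj (u $ y) = 0" by (simp add: v)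
    qed
  qed auto
  also have "\<dots> = (\<Sum>y\<in>?M. v $ y * cnj (u $ y)) + (\<Sum>y\<in>?Q. v $ y * cnj (u $ y))"
    using disj by (intro sum.union_disjoint) auto
  also have "\<dots> = (\<Sum>y\<in>?M. a * cnj (k i)) + (\<Sum>y\<in>?Q. b * cnj (k i))"
    by (intro arg_cong2[of _ _ _ _ "(+)"] sum.cong) (simp_all add: on[unfolded One_nat_def] v u)
  finally show ?thesis by (simp add: algebra_simps)
qed

lemma sphere_vec_nth:
  assumes "i > 0"
  shows "sphere_vec i $ y = (if \<partial> x y = i then if \<delta> y = i
    then of_nat (card (cell_plus adj C x (i - 1))) else - of_nat (card (cell_minus adj C x i)) else 0)"
  using assms clique_dist_base[of y]
  by (auto simp: sphere_vec_def char_vec_nth cell_minus_def cell_plus_def cell_def gsphere_def)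

lemma sphere_vec_in_U:
  assumes "i > 0"
  shows "sphere_vec i \<in> U"
proof -
  have "sphere_vec i \<in> W"
    unfolding clique_module_iff
    by (rule exI[of _ "\<lambda>m j. if m = i then if j = i then of_nat (card (cell_plus adj C x (i - 1)))
      else - of_nat (card (cell_minus adj C x i)) else 0"]) (simp only: sphere_vec_nth[OF assms] simp_thms)
  moreover have "cinner (sphere_vec i) u = 0" if u: "u \<in> P" for u
  proof -
    obtain k where k: "\<And>y. u $ y = k (\<partial> x y)" using u by (auto simp: primary_module_iff)
    show ?thesis unfolding cinner_on_sphere[OF assms sphere_vec_nth[OF assms] k] by simp
  qed
  ultimately show ?thesis by (simp add: orth_complement_in_def)
qed

lemma sphere_vec_nonzero:
  assumes "0 < i" "i < d"
  shows "sphere_vec i \<noteq> 0"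
proof -
  obtain y where y: "\<delta> y = i" "\<partial> x y = i"
    using cell_minus_nonempty[OF assms] by (auto simp: cell_minus_def cell_def gsphere_def)
  have "card (cell_plus adj C x (i - 1)) \<noteq> 0"
    using cell_plus_nonempty[of "i - 1"] assms by simp
  then have "sphere_vec i $ y \<noteq> 0" using y assms by (simp add: sphere_vec_nth)
  then show ?thesis by auto
qed

text \<open>The spheres of radius 0 and \<open>d\<close> contain a single cell, so a vector of the span of the cells
  supported on one of them lies in the primary module.\<close>

lemma supported_on_extreme_sphere:
  assumes v: "v \<in> U" and supp: "\<And>y. \<partial> x y \<noteq> i \<Longrightarrow> v $ y = 0" and i: "i = 0 \<or> i \<ge> d"
  shows "v = 0"
proof -
  obtain f where f: "\<And>y. v $ y = f (\<partial> x y) (\<delta> y)"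
    using v by (auto simp: orth_complement_in_def clique_module_iff)
  have "\<delta> y = \<partial> x y - 1" if "\<partial> x y = i" for y
    using clique_dist_base[of y] clique_dist_less_diam[of y] that i by auto
  then have "v \<in> P"
    using supp by (intro primary_moduleI[of _ "\<lambda>m. if m = i then f m (m - 1) else 0"]) (auto simp: f)
  then have "cinner v v = 0" using v by (simp add: orth_complement_in_def)
  then show ?thesis by simp
qed

lemma supported_on_sphere:
  assumes v: "v \<in> U" and supp: "\<And>y. \<partial> x y \<noteq> i \<Longrightarrow> v $ y = 0"
  shows "\<exists>c. v = c *s sphere_vec i"
proof (cases "i = 0")
  case True
  then have "v = 0 *s sphere_vec i"
    using supported_on_extreme_sphere[of v i] v supp by simp
  then show ?thesis ..
next
  case False
  then have i: "i > 0" by simp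
  obtain f where f: "\<And>y. v $ y = f (\<partial> x y) (\<delta> y)"
    using v by (auto simp: orth_complement_in_def clique_module_iff)
  define a b where "a = f i i" and "b = f i (i - 1)"
  let ?m = "of_nat (card (cell_minus adj C x i)) :: complex"
  let ?l = "of_nat (card (cell_plus adj C x (i - 1))) :: complex"
  have nth: "v $ y = (if \<partial> x y = i then if \<delta> y = i then a else b else 0)" for y
    using supp[of y] f[of y] clique_dist_base[of y] i by (auto simp: a_def b_def)
  define u :: "complex ^ 'v" where "u = (\<chi> y. if \<partial> x y = i then 1 else 0)"
  have un: "u $ y = (\<lambda>m. if m = i then 1 else 0) (\<partial> x y)" for y by (simp add: u_def)
  have "cinner v u = 0" using v primary_moduleI[OF un] by (simp add: orth_complement_in_def)
  then have rel: "?m * a + ?l * b = 0"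
    unfolding cinner_on_sphere[OF i nth un] by simp
  show ?thesis
  proof (cases "?m = 0")
    case True
    then have empty: "\<not> (\<partial> x y = i \<and> \<delta> y = i)" for y
      by (auto simp: cell_minus_def cell_def gsphere_def)
    have "v $ y = 0" for y
    proof (cases "\<partial> x y = i")
      case on: True
      then have "y \<in> cell_plus adj C x (i - 1)"
        using empty[of y] clique_dist_base[of y] i by (auto simp: cell_plus_def cell_def gsphere_def)
      then have "?l \<noteq> 0" by auto
      then show ?thesis using rel True empty[of y] by (simp add: nth)
    qed (simp add: nth)
    then have "v = 0 *s sphere_vec i" by (simp add: vec_eq_iff)
    then show ?thesis ..
  next
    case False
    then have "a = (- b / ?m) * ?l" using rel by (simp add: field_simps eq_neg_iff_add_eq_0)
    then have "v = (- b / ?m) *s sphere_vec i"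
      using False by (simp add: vec_eq_iff nth sphere_vec_nth[OF i])
    then show ?thesis ..
  qed
qed

lemma dual_idempotent_U_multiple:
  assumes "w \<in> U"
  shows "\<exists>c. dual_idempotent adj x i *v w = c *s sphere_vec i"
  using dual_idempotent_U[OF assms]
  by (rule supported_on_sphere) (simp add: dual_idempotent_vec)

lemma thin_U: "thin_module adj d x U"
  unfolding thin_module_def
proof (intro allI impI)
  fix i
  have "(\<lambda>w. dual_idempotent adj x i *v w) ` U \<subseteq> vec.span {sphere_vec i}"
  proof
    fix v assume "v \<in> (\<lambda>w. dual_idempotent adj x i *v w) ` U"
    then obtain c where "v = c *s sphere_vec i" using dual_idempotent_U_multiple by auto
    then show "v \<in> vec.span {sphere_vec i}" by (simp add: vec.span_scale vec.span_base)
  qed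
  then have "vec.dim ((\<lambda>w. dual_idempotent adj x i *v w) ` U) \<le> card {sphere_vec i}"
    by (rule vec.dim_le_card) simp
  then show "vec.dim ((\<lambda>w. dual_idempotent adj x i *v w) ` U) \<le> 1" by simp
qed

lemma zero_in_U: "0 \<in> U"
  by (rule vec.subspace_0[OF subspace_U])

lemma dual_support_U: "module_support d (dual_idempotent adj x) U = {1..d - 1}"
proof -
  have support: "(\<lambda>w. dual_idempotent adj x i *v w) ` U \<noteq> {0} \<longleftrightarrow> i \<in> {1..d - 1}" if "i \<le> d" for i
  proof
    assume ne: "(\<lambda>w. dual_idempotent adj x i *v w) ` U \<noteq> {0}"
    show "i \<in> {1..d - 1}"
    proof (rule ccontr)
      assume "\<not> ?thesis"
      then have i: "i = 0 \<or> i \<ge> d" by auto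
      have "dual_idempotent adj x i *v w = 0" if "w \<in> U" for w
        using dual_idempotent_U[OF that]
        by (rule supported_on_extreme_sphere[OF _ _ i]) (simp add: dual_idempotent_vec)
      then show False using ne zero_in_U by auto
    qed
  next
    assume i: "i \<in> {1..d - 1}"
    have "dual_idempotent adj x i *v sphere_vec i = sphere_vec i"
      using i by (auto simp: vec_eq_iff dual_idempotent_vec sphere_vec_nth)
    then show "(\<lambda>w. dual_idempotent adj x i *v w) ` U \<noteq> {0}"
      using i sphere_vec_in_U[of i] sphere_vec_nonzero[of i] by force
  qed
  show ?thesis
  proof (rule set_eqI)
    fix i
    show "i \<in> module_support d (dual_idempotent adj x) U \<longleftrightarrow> i \<in> {1..d - 1}"
    proof (cases "i \<le> d")
      case True
      show ?thesis using support[OF True] True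
        by (simp only: module_support_def mem_Collect_eq simp_thms)
    next
      case False
      then show ?thesis by (simp add: module_support_def)
    qed
  qed
qed

text \<open>With $u$ the vector \<open>clique_part\<close>, $c=|C|$, $k$ the valency and $\varepsilon$ the diagonal entry
  of $E_1$, the inner product of $E_1u$ and $u$ is
  $\varepsilon(c-1)(1-\theta_1/k)(1-\theta_1/\theta_d)$. It is nonzero since
  $\theta_d<\theta_1<\theta_0=k$.\<close>

lemma E_clique_part_nonzero: "E 1 *v clique_part \<noteq> 0"
proof -
  let ?c = "real (card C)" and ?k = "real (valency p)"
  let ?a = "(?c - 1) / ?k"
  let ?e = "entry 1 0 * (1 - \<theta> 1 / \<theta> d)"
  let ?b = "axis x 1 + of_real ?a *s (A *v axis x 1)"
  have d1: "1 \<le> d" using d_ge by simp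
  have b: "?b \<in> P"
  proof -
    have "?b = (mat 1 + mscale (of_real ?a) A) *v axis x 1"
      by (simp add: matrix_vector_mult_add_rdistrib mscale_vec mat_vec)
    then show ?thesis
      using radial_axis_in_primary[OF radial_add[OF radial_mat radial_mscale[OF radial_A]]] by simp
  qed
  have "cinner (E 1 *v clique_part) ?b = 0"
    using radial_U[OF E_radial[OF d1] clique_part_in_U] b by (simp add: orth_complement_in_def)
  moreover have "char_vec C = clique_part + ?b" by (simp add: clique_part_def)
  ultimately have "cinner (E 1 *v clique_part) clique_part = cinner (E 1 *v clique_part) (char_vec C)"
    using cinner_commute[of "E 1 *v clique_part"] by (simp add: cinner_add_left)
  also have "\<dots> = cinner (E 1 *v char_vec C) (char_vec C) - cinner (E 1 *v ?b) (char_vec C)"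
    by (simp add: clique_part_def matrix_vector_mult_diff_distrib cinner_diff_left)
  also have "cinner (E 1 *v char_vec C) (char_vec C) = of_real (?c * ?e)"
  proof -
    have "cinner (E 1 *v char_vec C) (char_vec C) = (\<Sum>y\<in>C. (E 1 *v char_vec C) $ y)"
      by (simp add: cinner_def char_vec_nth if_distrib[of cnj] if_distrib[of "\<lambda>t. _ * t"] sum.If_cases cong: if_cong)
    also have "\<dots> = (\<Sum>y\<in>C. of_real ?e)" by (intro sum.cong E_clique d1 refl)
    finally show ?thesis by simp
  qed
  also have "cinner (E 1 *v ?b) (char_vec C) = of_real ((1 + ?a * \<theta> 1) * ?e)"
  proof -
    have "E 1 *v (A *v axis x 1) = of_real (\<theta> 1) *s (E 1 *v axis x 1)"
      using A_E[OF d1] radial_commute[OF radial_A E_radial[OF d1]]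
      by (metis matrix_vector_mul_assoc mscale_vec)
    then have Eb: "E 1 *v ?b = of_real (1 + ?a * \<theta> 1) *s (E 1 *v axis x 1)"
      by (simp add: matrix_vector_right_distrib vec.scale vec.scale_left_distrib)
    have "cinner (E 1 *v ?b) (char_vec C)
        = of_real (1 + ?a * \<theta> 1) * cinner (axis x 1) (E 1 *v char_vec C)"
      unfolding Eb cinner_scale_left cinner_E[OF d1] ..
    also have "cinner (axis x 1) (E 1 *v char_vec C) = cnj ((E 1 *v char_vec C) $ x)"
      by (simp add: cinner_def axis_nth_if if_distrib[of "\<lambda>t. t * _"] cong: if_cong)
    also have "\<dots> = of_real ?e" unfolding E_clique[OF d1 x_in_C] by simp
    finally show ?thesis by simp
  qed
  also have "complex_of_real (?c * ?e) - of_real ((1 + ?a * \<theta> 1) * ?e)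
      = of_real ((?c - 1) * (1 - \<theta> 1 / ?k) * ?e)"
    by (simp add: algebra_simps flip: of_real_diff)
  finally have val: "cinner (E 1 *v clique_part) clique_part = of_real ((?c - 1) * (1 - \<theta> 1 / ?k) * ?e)" .
  have "?c - 1 > 0"
    unfolding card_clique_minus_1 using valency_pos least_eigenvalue_neg by (simp add: divide_pos_neg)
  moreover have "\<theta> 1 < ?k" using eigenvalue_0 decreasing[of 0 1] d1 by simp
  moreover have "\<theta> 1 \<noteq> \<theta> d" using decreasing[of 1 d] d_ge by simp
  ultimately have "(?c - 1) * (1 - \<theta> 1 / ?k) * ?e \<noteq> 0"
    using entry_0_pos[OF d1] valency_pos least_eigenvalue_neg by simp
  then show ?thesis using val by (auto simp del: of_real_mult)
qed

text \<open>\<open>E 0\<close> annihilates \<open>U\<close> because the all-ones vector lies in the primary module.\<close>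

lemma dual_endpoint_U: "dual_endpoint d E U = 1"
proof -
  have "E 0 *v w = 0" if "w \<in> U" for w
  proof -
    have "(\<chi> y. 1) \<in> P" by (rule primary_moduleI[of _ "\<lambda>m. 1"]) simp
    then have "cinner w (\<chi> y. 1) = 0" using that by (simp add: orth_complement_in_def)
    then have "(\<Sum>y\<in>UNIV. w $ y) = 0" by (simp add: cinner_def)
    then show ?thesis
      by (simp add: vec_eq_iff matrix_vector_mult_def E_0 flip: sum_distrib_left sum_divide_distrib)
  qed
  then have "(\<lambda>w. E 0 *v w) ` U = {0}" using zero_in_U by auto
  moreover have "(\<lambda>w. E 1 *v w) ` U \<noteq> {0}"
    using E_clique_part_nonzero clique_part_in_U by blast
  ultimately have S: "0 \<notin> module_support d E U" "1 \<in> module_support d E U"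
    using d_ge by (simp_all add: module_support_def)
  have "finite (module_support d E U)" by (simp add: module_support_def)
  then show ?thesis
    unfolding dual_endpoint_def endpoint_wrt_def using S
    by (intro Min_eqI) (auto simp: Suc_le_eq intro: gr0I)
qed

end

section \<open>Irreducibility\<close>

lemma leonard_dual_eigenvalues_distinct:
  assumes "leonard_system V n B B' F F'" and "eigenvalue_sequence V n B' F' \<mu>'"
  shows "inj_on \<mu>' {..n}"
proof -
  obtain \<mu> where \<mu>: "bij_betw \<mu> {..n} (eigenvalues_on V B')"
    "\<And>i j v. i \<le> n \<Longrightarrow> j \<le> n \<Longrightarrow> v \<in> V \<Longrightarrow> B' *v v = \<mu> j *s v \<Longrightarrow> F' i *v v = (if i = j then v else 0)"
    using assms(1) unfolding leonard_system_def spectral_ordering_def by blast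
  have "\<mu>' i = \<mu> i" if "i \<le> n" for i
  proof -
    have "\<mu> i \<in> eigenvalues_on V B'" using \<mu>(1) that by (auto simp: bij_betw_def)
    then obtain v where v: "v \<in> V" "v \<noteq> 0" "B' *v v = \<mu> i *s v" by (auto simp: eigenvalues_on_def)
    then have "F' i *v v = v" using \<mu>(2)[OF that that] by simp
    then have "B' *v v = \<mu>' i *s v" using assms(2) that v(1) by (metis eigenvalue_sequence_def)
    then show ?thesis using v by simp
  qed
  then show ?thesis using \<mu>(1) by (simp add: bij_betw_def inj_on_def)
qed

text \<open>The setting of a Delsarte clique, with the distinct eigenvalues \<open>\<theta>' i\<close> of the dual adjacency
  matrix with respect to \<open>x\<close>.\<close>

locale delsarte_terwilliger = delsarte_drg adj d p E \<theta> C x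
  for adj :: "'v::finite \<Rightarrow> 'v \<Rightarrow> bool" and d p E \<theta> C x +
  fixes \<theta>' :: "nat \<Rightarrow> complex"
  assumes dual_spectral:
      "dual_adjacency E x = (\<Sum>i\<le>d. mscale (\<theta>' i) (dual_idempotent adj x i))"
    and dual_distinct: "inj_on \<theta>' {..d}"
begin

abbreviation T :: "(complex ^ 'v ^ 'v) set" where
  "T \<equiv> terwilliger_algebra adj E x"

lemma dual_adjacency_vec: "(dual_adjacency E x *v w) $ y = \<theta>' (\<partial> x y) * w $ y"
proof -
  have "(dual_adjacency E x *v w) $ y = (\<Sum>i\<le>d. if i = \<partial> x y then \<theta>' i * w $ y else 0)"
    unfolding dual_spectral matrix_sum_vec sum_component mscale_vec
    by (intro sum.cong) (auto simp: dual_idempotent_vec)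
  then show ?thesis by (simp add: gdist_le_diam)
qed

lemma alg_module_U: "alg_module T U"
  unfolding terwilliger_algebra_def
proof (rule alg_module_gen_alg[OF subspace_U])
  fix B w assume "B \<in> {A, dual_adjacency E x}" and w: "w \<in> U"
  then consider "B = A" | "B = dual_adjacency E x" by blast
  then show "B *v w \<in> U"
  proof cases
    case 1 then show ?thesis using radial_U[OF radial_A w] by simp
  next
    case 2
    have "B *v w = (\<chi> y. \<theta>' (\<partial> x y) * w $ y)"
      by (simp add: vec_eq_iff dual_adjacency_vec 2)
    then show ?thesis using diagonal_U[OF w] by simp
  qed
qed

lemma radial_in_T: "radial B \<Longrightarrow> B \<in> T"
  unfolding bose_mesner_iff_radial[symmetric] bose_mesner_def terwilliger_algebra_def
  by (erule gen_alg_mono) simp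

text \<open>Up to a factor, each dual idempotent is a polynomial in the dual adjacency
  matrix.\<close>

lemma sphere_projection_in_T:
  assumes "i \<le> d"
  obtains B c where "B \<in> T" "c \<noteq> 0" "\<And>w. B *v w = c *s (dual_idempotent adj x i *v w)"
proof -
  have "\<exists>B\<in>T. \<forall>w y. (B *v w) $ y = (\<Prod>j\<in>J. \<theta>' (\<partial> x y) - \<theta>' j) * w $ y" if "finite J" for J
    using that
  proof (induction J)
    case empty
    show ?case unfolding terwilliger_algebra_def
      by (intro bexI[of _ "mat 1"] gen_alg.scalar) (simp add: mat_vec)
  next
    case (insert j J)
    then obtain B where B: "B \<in> T" "\<And>w y. (B *v w) $ y = (\<Prod>j\<in>J. \<theta>' (\<partial> x y) - \<theta>' j) * w $ y" by blast
    have "(dual_adjacency E x + mat (- \<theta>' j)) ** B \<in> T"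
      using B(1) unfolding terwilliger_algebra_def
      by (intro gen_alg.times gen_alg.plus gen_alg.scalar gen_alg.generator[of "dual_adjacency E x"]) simp_all
    moreover have "(((dual_adjacency E x + mat (- \<theta>' j)) ** B) *v w) $ y
        = (\<Prod>j\<in>insert j J. \<theta>' (\<partial> x y) - \<theta>' j) * w $ y" for w y
      using insert(1,2)
      by (simp add: matrix_vector_mult_add_rdistrib dual_adjacency_vec mat_vec B(2) algebra_simps
        flip: matrix_vector_mul_assoc)
    ultimately show ?case by blast
  qed
  from this[of "{..d} - {i}"] obtain B where B: "B \<in> T"
    "\<And>w y. (B *v w) $ y = (\<Prod>j\<in>{..d} - {i}. \<theta>' (\<partial> x y) - \<theta>' j) * w $ y" by auto
  define c where "c = (\<Prod>j\<in>{..d} - {i}. \<theta>' i - \<theta>' j)"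
  have "c \<noteq> 0" using dual_distinct assms by (auto simp: c_def inj_on_def)
  moreover have "B *v w = c *s (dual_idempotent adj x i *v w)" for w
  proof -
    have "(\<Prod>j\<in>{..d} - {i}. \<theta>' (\<partial> x y) - \<theta>' j) = 0" if "\<partial> x y \<noteq> i" for y
      using that gdist_le_diam[of x y] by (intro prod_zero) auto
    then show ?thesis by (auto simp: vec_eq_iff B(2) dual_idempotent_vec c_def)
  qed
  ultimately show ?thesis using B(1) that by blast
qed

text \<open>The part of \<open>U\<close> on the first sphere is the line spanned by \<open>clique_part\<close>, which generates \<open>U\<close>.
  A submodule either contains this line, and then is all of \<open>U\<close>, or is orthogonal to \<open>clique_part\<close>;
  being invariant under the Bose-Mesner algebra it is then orthogonal to \<open>U\<close> and so zero.\<close>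

lemma irreducible_U: "irreducible_module T U"
  unfolding irreducible_module_def
proof (intro conjI allI impI alg_module_U)
  show "U \<noteq> {0}" using sphere_vec_in_U[of 1] sphere_vec_nonzero[of 1] d_ge by auto
  fix S assume "alg_module T S \<and> S \<subseteq> U"
  then have S: "vec.subspace S" "S \<subseteq> U" and closed: "\<And>B w. B \<in> T \<Longrightarrow> w \<in> S \<Longrightarrow> B *v w \<in> S"
    by (auto simp: alg_module_def)
  obtain a where a: "clique_part = a *s sphere_vec 1"
    using supported_on_sphere[OF clique_part_in_U, of 1] by (auto simp: clique_part_nth)
  show "S = {0} \<or> S = U"
  proof (cases "\<exists>w\<in>S. dual_idempotent adj x 1 *v w \<noteq> 0")
    case True
    then obtain w where w: "w \<in> S" "dual_idempotent adj x 1 *v w \<noteq> 0" by blast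
    obtain B c where B: "B \<in> T" "c \<noteq> 0" "\<And>w. B *v w = c *s (dual_idempotent adj x 1 *v w)"
      using sphere_projection_in_T[of 1] d_ge by auto
    obtain b where b: "dual_idempotent adj x 1 *v w = b *s sphere_vec 1"
      using dual_idempotent_U_multiple w(1) S(2) by blast
    have "b \<noteq> 0" using w(2) b by auto
    have "clique_part = (a / (c * b)) *s (B *v w)"
      using B(2) \<open>b \<noteq> 0\<close> by (simp only: B(3) a b) simp
    then have "clique_part \<in> S"
      using closed[OF B(1) w(1)] vec.subspace_scale[OF S(1)] by simp
    then have "U \<subseteq> S" using closed radial_in_T U_cyclic by (metis subsetI)
    then show ?thesis using S(2) by blast
  next
    case False
    have orth: "cinner w clique_part = 0" if "w \<in> S" for w
    proof -
      have "dual_idempotent adj x 1 *v w = 0" using False that by blast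
      then have "w $ y = 0" if "\<partial> x y = 1" for y
        using dual_idempotent_vec[of 1 w y] that by simp
      then show ?thesis unfolding cinner_def by (intro sum.neutral) (auto simp: clique_part_nth)
    qed
    have "w = 0" if w: "w \<in> S" for w
    proof -
      obtain D where D: "radial D" "w = D *v clique_part" using U_cyclic[of w] S(2) w by auto
      have "cinner (mat_cnj D *v w) clique_part = 0"
        using orth closed radial_in_T radial_mat_cnj[OF D(1)] w by blast
      then have "cinner w (D *v clique_part) = 0"
        using cinner_radial[OF radial_mat_cnj[OF D(1)], of w clique_part] by simp
      then have "cinner w w = 0" using D(2) by simp
      then show ?thesis by simp
    qed
    then have "S = {0}" using vec.subspace_0[OF S(1)] by blast
    then show ?thesis ..
  qed
qed

end

theorem lemma6p1:
  fixes adj :: "'v::finite \<Rightarrow> 'v \<Rightarrow> bool"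
    and d :: nat
    and p :: "nat \<Rightarrow> nat \<Rightarrow> nat \<Rightarrow> nat"
    and E :: "nat \<Rightarrow> complex ^ 'v ^ 'v"
    and \<theta> :: "nat \<Rightarrow> real"
    and \<theta>' \<phi> \<psi> :: "nat \<Rightarrow> complex"
    and C :: "'v set"
    and x :: 'v
    and q h h' s s' r1 r2 :: complex
  assumes "connected_simple_graph adj"
    and "d = gdiam adj" and "d \<ge> 3"
    and "distance_regular adj p"
    and "primitive_idempotent_ordering adj d E"
    and "adjacency_matrix adj = (\<Sum>i\<le>d. mscale (of_real (\<theta> i)) (E i))"
    and "Q_polynomial d E"
    and "\<And>i j. i < j \<Longrightarrow> j \<le> d \<Longrightarrow> \<theta> i > \<theta> j"
    and "delsarte_clique adj p (\<theta> d) C"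
    and "x \<in> C"
    and "dual_adjacency E x = (\<Sum>i\<le>d. mscale (\<theta>' i) (dual_idempotent adj x i))"
    and "leonard_system_with_parameter_array (primary_module adj x) d
           (adjacency_matrix adj) (dual_adjacency E x) E (dual_idempotent adj x)
           (\<lambda>i. of_real (\<theta> i)) \<theta>' \<phi> \<psi>"
    and "q \<noteq> 0" and "q\<^sup>2 \<noteq> 1"
    and "q_racah_array d q h h' s s' r1 r2 (\<lambda>i. of_real (\<theta> i)) \<theta>' \<phi> \<psi>"
  defines "U \<equiv> orth_complement_in (clique_module adj d C x) (primary_module adj x)"
  shows "irreducible_module (terwilliger_algebra adj E x) U \<and>
         thin_module adj d x U \<and>
         endpoint adj d x U = 1 \<and>
         dual_endpoint d E U = 1 \<and>
         module_diameter adj d x U = d - 2"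
proof -
  have distinct: "inj_on \<theta>' {..d}"
    using assms(12) unfolding leonard_system_with_parameter_array_def
    by (blast intro: leonard_dual_eigenvalues_distinct)
  interpret delsarte_terwilliger adj d p E \<theta> C x \<theta>'
    by unfold_locales (fact assms distinct)+
  have "endpoint adj d x U = 1"
    using d_ge by (simp add: U_def endpoint_def endpoint_wrt_def dual_support_U)
      (rule Min_eqI, auto)
  moreover have "module_diameter adj d x U = d - 2"
    by (simp add: U_def module_diameter_def dual_support_U)
  ultimately show ?thesis
    using irreducible_U thin_U dual_endpoint_U by (simp add: U_def)
qed

end
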